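(* Let $Y$ be a uniformly smooth real Banach space with a monotone Schauder basis. The following are equivalent: (1) For every Banach space $X$ with an octahedral norm and every closed subspace $H$ with $X\otimes Y\subseteq H\subseteq L(Y^*,X)$, $H$ has an octahedral norm. (2) $Y\widehat{\otimes}_\varepsilon X$ has an octahedral norm for every Banach space $X$ with an octahedral norm. (3) $Y\widehat{\otimes}_\varepsilon\ell_1$ has an octahedral norm. (4) $Y^*$ is finitely representable in $\ell_1$. (5) $Y^*$ embeds isometrically into $L_1$.
   Context: All Banach spaces are real. $\widehat{\otimes}_\varepsilon$ is the injective tensor product. $L(Y^*,X)$ carries the operator norm and $X\otimes Y$ is identified with the finite-rank operators $y^*\mapsto\sum_i y^*(y_i)x_i$. A Schauder basis is monotone if its basis projections have norm at most $1$. A Banach space $Z$ is finitely representable in $\ell_1$ if for every finite-dimensional subspace $F$ of $Z$ and every $\varepsilon>0$ there is a linear map $T:F\to\ell_1$ with $\Vert T\Vert\Vert T^{-1}\Vert\le 1+\varepsilon$ on $T(F)$. A Banach space $Z$ has an octahedral norm if for every finite-dimensional subspace $F$ of $Z$ and every $\varepsilon>0$ there exists $x\in S_Z$ such that $\Vert f+\lambda x\Vert\ge(1-\varepsilon)(\Vert f\Vert+|\lambda|)$ for all $f\in F$, $\lambda\in\mathbb R$. *)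

theory Defs
  imports "HOL-Analysis.Analysis"
begin

typedef ell1 = "{f::nat \<Rightarrow> real. summable (\<lambda>n. \<bar>f n\<bar>)}"
  morphisms ell1_seq Abs_ell1
  by (rule exI[of _ "\<lambda>_. 0"]) simp

setup_lifting type_definition_ell1

lemma ell1_summable_add:
  assumes "summable (\<lambda>n. \<bar>f n\<bar>)" "summable (\<lambda>n. \<bar>g n\<bar>)"
  shows "summable (\<lambda>n. \<bar>(f n::real) + g n\<bar>)"
  by (rule summable_comparison_test[where g="\<lambda>n. \<bar>f n\<bar> + \<bar>g n\<bar>"])
     (auto intro: summable_add assms)

instantiation ell1 :: real_vector
begin
lift_definition zero_ell1 :: ell1 is "\<lambda>_. 0" by simp
lift_definition plus_ell1 :: "ell1 \<Rightarrow> ell1 \<Rightarrow> ell1" is "\<lambda>f g n. f n + g n"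
  by (rule ell1_summable_add)
lift_definition uminus_ell1 :: "ell1 \<Rightarrow> ell1" is "\<lambda>f n. - f n" by simp
lift_definition minus_ell1 :: "ell1 \<Rightarrow> ell1 \<Rightarrow> ell1" is "\<lambda>f g n. f n - g n"
  using ell1_summable_add[of _ "\<lambda>n. - _ n"] by simp
lift_definition scaleR_ell1 :: "real \<Rightarrow> ell1 \<Rightarrow> ell1" is "\<lambda>c f n. c * f n"
  by (simp add: abs_mult summable_mult)
instance
  by standard (transfer; auto simp: algebra_simps)+
end

instantiation ell1 :: real_normed_vector
begin
lift_definition norm_ell1 :: "ell1 \<Rightarrow> real" is "\<lambda>f. \<Sum>n. \<bar>f n\<bar>" .
definition dist_ell1 :: "ell1 \<Rightarrow> ell1 \<Rightarrow> real" where "dist_ell1 x y = norm (x - y)"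
definition sgn_ell1 :: "ell1 \<Rightarrow> ell1" where "sgn_ell1 x = inverse (norm x) *\<^sub>R x"
definition uniformity_ell1 :: "(ell1 \<times> ell1) filter" where
  "uniformity_ell1 = (INF e\<in>{0<..}. principal {(x, y). dist x y < e})"
definition open_ell1 :: "ell1 set \<Rightarrow> bool" where
  "open_ell1 U = (\<forall>x\<in>U. \<forall>\<^sub>F (x', y) in uniformity. x' = x \<longrightarrow> y \<in> U)"
instance
proof
  fix x y :: ell1 and a :: real
  show "norm x = 0 \<longleftrightarrow> x = 0"
  proof transfer
    fix f :: "nat \<Rightarrow> real" assume s: "summable (\<lambda>n. \<bar>f n\<bar>)"
    have "(\<Sum>n. \<bar>f n\<bar>) = 0 \<longleftrightarrow> (\<forall>n. \<bar>f n\<bar> = 0)"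
      using suminf_eq_zero_iff[OF s] by simp
    then show "((\<Sum>n. \<bar>f n\<bar>) = 0) = (f = (\<lambda>_. 0))" by auto
  qed
  show "norm (x + y) \<le> norm x + norm y"
  proof transfer
    fix f g :: "nat \<Rightarrow> real"
    assume sf: "summable (\<lambda>n. \<bar>f n\<bar>)" and sg: "summable (\<lambda>n. \<bar>g n\<bar>)"
    have "(\<Sum>n. \<bar>f n + g n\<bar>) \<le> (\<Sum>n. \<bar>f n\<bar> + \<bar>g n\<bar>)"
      by (rule suminf_le) (auto intro: ell1_summable_add sf sg summable_add)
    also have "\<dots> = (\<Sum>n. \<bar>f n\<bar>) + (\<Sum>n. \<bar>g n\<bar>)" by (rule suminf_add[OF sf sg, symmetric])
    finally show "(\<Sum>n. \<bar>f n + g n\<bar>) \<le> (\<Sum>n. \<bar>f n\<bar>) + (\<Sum>n. \<bar>g n\<bar>)" .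
  qed
  show "norm (a *\<^sub>R x) = \<bar>a\<bar> * norm x"
    by transfer (simp add: abs_mult suminf_mult)
qed (auto simp: dist_ell1_def sgn_ell1_def uniformity_ell1_def open_ell1_def)
end

text \<open>Octahedrality of (the norm restricted to) a subset H of a normed space;
  finite-dimensional subspaces of H are the spans of finite subsets of H.
  A space has an octahedral norm iff octahedral_on UNIV.\<close>
definition octahedral_on :: "'a::real_normed_vector set \<Rightarrow> bool" where
  "octahedral_on H \<longleftrightarrow>
     (\<forall>S \<epsilon>. finite S \<and> S \<subseteq> H \<and> \<epsilon> > 0 \<longrightarrow>
        (\<exists>x\<in>H. norm x = 1 \<and>
           (\<forall>f\<in>span S. \<forall>c::real. norm (f + c *\<^sub>R x) \<ge> (1 - \<epsilon>) * (norm f + \<bar>c\<bar>))))"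

text \<open>The algebraic tensor product X \<otimes> Y, as finite-rank operators
  y* \<mapsto> \<Sum> y*(y_i) x_i in L(Y*, X).\<close>
definition alg_tensor :: "(('y::real_normed_vector \<Rightarrow>\<^sub>L real) \<Rightarrow>\<^sub>L 'x::real_normed_vector) set" where
  "alg_tensor = {T. \<exists>(n::nat) (y::nat \<Rightarrow> 'y) (x::nat \<Rightarrow> 'x).
      \<forall>\<phi>. blinfun_apply T \<phi> = (\<Sum>i<n. blinfun_apply \<phi> (y i) *\<^sub>R x i)}"

definition inj_tensor :: "(('y::real_normed_vector \<Rightarrow>\<^sub>L real) \<Rightarrow>\<^sub>L 'x::real_normed_vector) set" where
  "inj_tensor = closure alg_tensor"

definition uniformly_smooth :: "'a::real_normed_vector itself \<Rightarrow> bool" where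
  "uniformly_smooth _ \<longleftrightarrow>
     (\<forall>\<epsilon>>0. \<exists>\<delta>>0. \<forall>(x::'a) (y::'a) (\<tau>::real).
        norm x = 1 \<and> norm y = 1 \<and> 0 < \<tau> \<and> \<tau> < \<delta> \<longrightarrow>
        norm (x + \<tau> *\<^sub>R y) + norm (x - \<tau> *\<^sub>R y) \<le> 2 + \<epsilon> * \<tau>)"

definition schauder_basis :: "(nat \<Rightarrow> 'a::real_normed_vector) \<Rightarrow> bool" where
  "schauder_basis e \<longleftrightarrow>
     (\<forall>y. \<exists>!a::nat \<Rightarrow> real. (\<lambda>n. \<Sum>i<n. a i *\<^sub>R e i) \<longlonglongrightarrow> y)"

definition monotone_schauder_basis :: "(nat \<Rightarrow> 'a::real_normed_vector) \<Rightarrow> bool" where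
  "monotone_schauder_basis e \<longleftrightarrow> schauder_basis e \<and>
     (\<forall>y a n. (\<lambda>m. \<Sum>i<m. a i *\<^sub>R e i) \<longlonglongrightarrow> y \<longrightarrow> norm (\<Sum>i<n. a i *\<^sub>R e i) \<le> norm y)"

definition fin_rep_ell1 :: "'a::real_normed_vector itself \<Rightarrow> bool" where
  "fin_rep_ell1 _ \<longleftrightarrow>
     (\<forall>(S::'a set) \<epsilon>. finite S \<and> \<epsilon> > 0 \<longrightarrow>
        (\<exists>T::'a \<Rightarrow> ell1.
           (\<forall>f\<in>span S. \<forall>g\<in>span S. T (f + g) = T f + T g) \<and>
           (\<forall>f\<in>span S. \<forall>c. T (c *\<^sub>R f) = c *\<^sub>R T f) \<and>
           (\<exists>m M. 0 < m \<and> M \<le> (1 + \<epsilon>) * m \<and>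
              (\<forall>f\<in>span S. m * norm f \<le> norm (T f) \<and> norm (T f) \<le> M * norm f))))"

text \<open>Isometric linear embedding into L_1[0,1] (functions taken as representatives).\<close>
definition embeds_L1 :: "'a::real_normed_vector itself \<Rightarrow> bool" where
  "embeds_L1 _ \<longleftrightarrow>
     (\<exists>T::'a \<Rightarrow> real \<Rightarrow> real.
        (\<forall>f g. T (f + g) = (\<lambda>t. T f t + T g t)) \<and>
        (\<forall>c f. T (c *\<^sub>R f) = (\<lambda>t. c * T f t)) \<and>
        (\<forall>f. set_integrable lborel {0..1} (T f) \<and>
             norm f = set_lebesgue_integral lborel {0..1} (\<lambda>t. \<bar>T f t\<bar>)))"

definition prop1 :: "'y::real_normed_vector itself \<Rightarrow> 'x::real_normed_vector itself \<Rightarrow> bool" where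
  "prop1 _ _ \<longleftrightarrow>
     (complete (UNIV::'x set) \<and> octahedral_on (UNIV::'x set) \<longrightarrow>
       (\<forall>H::(('y \<Rightarrow>\<^sub>L real) \<Rightarrow>\<^sub>L 'x) set.
          closed H \<and> subspace H \<and> alg_tensor \<subseteq> H \<longrightarrow> octahedral_on H))"

definition prop2 :: "'y::real_normed_vector itself \<Rightarrow> 'x::real_normed_vector itself \<Rightarrow> bool" where
  "prop2 _ _ \<longleftrightarrow>
     (complete (UNIV::'x set) \<and> octahedral_on (UNIV::'x set) \<longrightarrow>
        octahedral_on (inj_tensor :: (('y \<Rightarrow>\<^sub>L real) \<Rightarrow>\<^sub>L 'x) set))"

end

(* Idea.  Write Q_n for the adjoints of the basis projections of Y.  Uniform smoothness of Y says that
   functionals in the unit ball that are almost normed by the same vector are close to each other;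
   monotonicity of the basis then gives Q_n phi -> phi for all phi in Y*.

   (3) => (4): apply octahedrality to rank-one operators y (x) u, with y almost normed by functionals phi
   from a net of the unit sphere of a finite-dimensional subspace.  The direction G almost adds up in
   norm with y (x) u, which forces a functional psi with psi(y) and |G psi| both close to 1; psi is close
   to phi, so G itself is an almost isometry into l_1.

   (4) => (1): follow Q_n by an almost isometry of its range into l_1, and replace the unit vectors of
   l_1 by a sequence in X that is octahedral over the (finite-dimensional) span of the relevant images.

   (5) => (4): average over a fine finite partition of [0,1].

   (4) => (5): after a change of density the almost isometries into l_1 become uniformly bounded random
   variables; code their joint laws as laws on [0,1], take a weak limit (Helly) and realise it by its
   quantile function. *)

theory Submission
  imports Defs "HOL-Probability.Helly_Selection"
begin

section \<open>The space \<open>\<ell>\<^sub>1\<close> and finite-dimensional subspaces\<close>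

text \<open>Octahedrality is uniform over a finite-dimensional subspace, while its ingredients
  (\<open>Q n \<phi>\<close> tends to \<open>\<phi>\<close>, partial sums in ell_1 tend to the norm)
  converge only pointwise. A Dini argument on the compact unit sphere of a span fixes one index for
  all its vectors. The obstacle in (4) => (5) is that Helly's theorem selects limits of laws on the
  line, whereas infinitely many random variables have to converge jointly. Coding them by a point x
  of [0,1] helps only if each \<open>\<bar>\<Sum>j<m. c j * G j x\<bar>\<close> is a bounded
  continuous function of x, because weak convergence is tested on such functions. Hence the code is
  Schoenberg's curve, continuous on the whole line and covering a Hilbert cube. Boundedness is what
  the change of density buys: division by the sum of 2^-(j+1) |T f_j| / norm f_j leaves variables
  bounded by a constant depending on j alone, and the total mass of this weight tends to 1, so
  normalising it costs nothing in the limit. The limit law represents only finite combinations of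
  the basis functionals; the rest of the dual is reached by \<open>Q_tendsto\<close> and
  completeness of L_1.\<close>

lemma compact_span_Int_cball:
  fixes S :: "'a::real_normed_vector set"
  assumes "finite S"
  shows "compact (span S \<inter> cball 0 r)"
  using assms
proof (induction S arbitrary: r)
  case empty
  have "span {} \<inter> cball (0::'a) r \<subseteq> {0}" by simp
  then show ?case
    using finite_imp_compact finite_subset by blast
next
  case (insert s S)
  show ?case
  proof (cases "s \<in> span S")
    case True
    then show ?thesis using insert by (simp add: span_redundant)
  next
    case False
    \<comment> \<open>A convergent sequence is bounded, so the induction hypothesis for a large
      radius already makes the smaller span closed. Hence \<open>s\<close> has a positive distance
      \<open>d\<close> from it, and \<open>d\<close> controls the coefficient of
      \<open>s\<close>.\<close>
    have "closed (span S)"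
      unfolding closed_sequential_limits
    proof (intro allI impI, elim conjE)
      fix x l assume x: "\<forall>n. x n \<in> span S" and lim: "x \<longlonglongrightarrow> l"
      obtain r where r: "\<And>n. norm (x n) \<le> r"
        using lim convergent_imp_Bseq[of x] unfolding convergent_def Bseq_def by blast
      have "closed (span S \<inter> cball 0 r)"
        using insert.IH compact_imp_closed by blast
      moreover have "x n \<in> span S \<inter> cball 0 r" for n using x r by simp
      ultimately show "l \<in> span S"
        using lim closed_sequentially[of "span S \<inter> cball 0 r" x l] by blast
    qed
    then have "open (- span S)" by (simp add: open_Compl)
    then obtain d where "d > 0" and ball: "ball s d \<subseteq> - span S"
      using False open_contains_ball by blast
    then have d: "d > 0" "\<And>f. f \<in> span S \<Longrightarrow> d \<le> dist s f"
      by (auto simp: subset_iff not_less[symmetric])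
    have low: "\<bar>c\<bar> * d \<le> norm (f + c *\<^sub>R s)" if "f \<in> span S" for f c
    proof (cases "c = 0")
      case c: False
      have "(- inverse c) *\<^sub>R f \<in> span S" using that by (simp only: span_mul)
      then have "d \<le> norm (s - (- inverse c) *\<^sub>R f)"
        using d(2) by (simp only: dist_norm)
      then have "\<bar>c\<bar> * d \<le> norm (c *\<^sub>R (s - (- inverse c) *\<^sub>R f))"
        by (simp add: mult_left_mono)
      also have "c *\<^sub>R (s - (- inverse c) *\<^sub>R f) = f + c *\<^sub>R s"
        using c by (simp add: algebra_simps)
      finally show ?thesis .
    qed simp
    define K where "K = (\<lambda>(f, c). f + c *\<^sub>R s) `
      ((span S \<inter> cball 0 (r + r / d * norm s)) \<times> {- (r / d)..r / d})"
    have "compact K" unfolding K_def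
      by (intro compact_continuous_image compact_Times insert.IH compact_Icc)
         (auto simp: case_prod_unfold intro!: continuous_intros)
    moreover have "span (insert s S) \<inter> cball 0 r = K \<inter> cball 0 r"
    proof (intro equalityI subsetI)
      fix y assume y: "y \<in> span (insert s S) \<inter> cball 0 r"
      then obtain c where c: "y - c *\<^sub>R s \<in> span S"
        using span_breakdown_eq by blast
      have "\<bar>c\<bar> * d \<le> r" using low[OF c, of c] y by simp
      then have cb: "\<bar>c\<bar> \<le> r / d" using d by (simp add: field_simps)
      have "norm (y - c *\<^sub>R s) \<le> norm y + \<bar>c\<bar> * norm s"
        using norm_triangle_ineq4[of y "c *\<^sub>R s"] by simp
      also have "\<dots> \<le> r + r / d * norm s"
        using y cb by (intro add_mono mult_right_mono) auto
      finally have "(y - c *\<^sub>R s, c) \<in> (span S \<inter> cball 0 (r + r / d * norm s)) \<times> {- (r / d)..r / d}"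
        using c cb by auto
      then have "y \<in> K" unfolding K_def by (intro image_eqI[of _ _ "(y - c *\<^sub>R s, c)"]) auto
      then show "y \<in> K \<inter> cball 0 r" using y by blast
    next
      fix y assume "y \<in> K \<inter> cball 0 r"
      then show "y \<in> span (insert s S) \<inter> cball 0 r"
        unfolding K_def by (auto intro!: span_add span_mul intro: span_base
            span_mono[THEN subsetD, of S "insert s S"])
    qed
    ultimately show ?thesis by (simp add: compact_Int_closed)
  qed
qed

lemma compact_unit_sphere_span:
  fixes S :: "'a::real_normed_vector set"
  assumes "finite S"
  shows "compact {f \<in> span S. norm f = 1}"
proof -
  have "closed {f::'a. norm f = 1}" by (intro closed_Collect_eq continuous_intros)
  then have "compact ((span S \<inter> cball 0 1) \<inter> {f. norm f = 1})"
    by (intro compact_Int_closed compact_span_Int_cball assms)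
  moreover have "(span S \<inter> cball 0 1) \<inter> {f. norm f = 1} = {f \<in> span S. norm f = 1}" by auto
  ultimately show ?thesis by simp
qed

text \<open>Dini's principle: an increasing open cover of a compact sphere is exhausted at a finite
  stage. It turns pointwise statements "for some n" into one n for the whole span.\<close>

lemma uniform_on_unit_sphere_span:
  fixes S :: "'a::real_normed_vector set" and U :: "nat \<Rightarrow> 'a set"
  assumes "finite S" and "\<And>n. open (U n)" and "\<And>m n. m \<le> n \<Longrightarrow> U m \<subseteq> U n"
    and cover: "\<And>f. f \<in> span S \<Longrightarrow> norm f = 1 \<Longrightarrow> \<exists>n. f \<in> U n"
  obtains n where "\<And>f. f \<in> span S \<Longrightarrow> norm f = 1 \<Longrightarrow> f \<in> U n"
proof -
  have "{f \<in> span S. norm f = 1} \<subseteq> (\<Union>n\<in>UNIV. U n)" using cover by auto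
  then obtain C where C: "finite C" "{f \<in> span S. norm f = 1} \<subseteq> (\<Union>n\<in>C. U n)"
    by (rule compactE_image[OF compact_unit_sphere_span[OF assms(1)] assms(2)])
  obtain N where "C \<subseteq> {..N}" using C(1) finite_nat_iff_bounded_le by auto
  have "f \<in> U N" if f: "f \<in> span S" "norm f = 1" for f
  proof -
    obtain n where "n \<in> C" "f \<in> U n" using f C(2) by blast
    then show ?thesis using assms(3)[of n N] \<open>C \<subseteq> {..N}\<close> by auto
  qed
  then show thesis by (rule that)
qed

section \<open>Coordinates, completeness and octahedrality of ell_1\<close>

lemma summable_ell1_seq: "summable (\<lambda>k. \<bar>ell1_seq x k\<bar>)"
  using ell1_seq by blast

lemma norm_ell1_sums: "(\<lambda>k. \<bar>ell1_seq x k\<bar>) sums norm x"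
  by (simp add: norm_ell1.rep_eq summable_ell1_seq summable_sums)

lemma sum_ell1_seq_le_norm: "finite A \<Longrightarrow> (\<Sum>k\<in>A. \<bar>ell1_seq x k\<bar>) \<le> norm x"
  unfolding norm_ell1.rep_eq by (intro sum_le_suminf summable_ell1_seq) auto

lemma ell1_seq_le_norm: "\<bar>ell1_seq x k\<bar> \<le> norm x"
  using sum_ell1_seq_le_norm[of "{k}" x] by simp

lemma ell1_seq_sum: "ell1_seq (sum f A) k = (\<Sum>i\<in>A. ell1_seq (f i) k)"
  by (induction A rule: infinite_finite_induct) (auto simp: zero_ell1.rep_eq plus_ell1.rep_eq)

lemma bounded_linear_ell1_seq: "bounded_linear (\<lambda>x. ell1_seq x k)"
  by (rule bounded_linear_intro[of _ 1])
     (auto simp: plus_ell1.rep_eq scaleR_ell1.rep_eq ell1_seq_le_norm)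

lemma continuous_on_ell1_seq [continuous_intros]: "continuous_on A (\<lambda>x. ell1_seq x k)"
  by (rule linear_continuous_on[OF bounded_linear_ell1_seq])

lemma ell1_partial_sum_gt:
  assumes "r < norm x"
  shows "\<exists>n. r < (\<Sum>k<n. \<bar>ell1_seq x k\<bar>)"
proof -
  have "(\<lambda>n. \<Sum>k<n. \<bar>ell1_seq x k\<bar>) \<longlonglongrightarrow> norm x"
    using norm_ell1_sums sums_def by blast
  then have "\<forall>\<^sub>F n in sequentially. r < (\<Sum>k<n. \<bar>ell1_seq x k\<bar>)"
    using assms order_tendstoD(1) by blast
  then show ?thesis by (auto simp: eventually_sequentially)
qed

definition ell1_unit :: "nat \<Rightarrow> ell1" where
  "ell1_unit n = Abs_ell1 (\<lambda>k. if k = n then 1 else 0)"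

lemma ell1_seq_unit: "ell1_seq (ell1_unit n) k = (if k = n then 1 else 0)"
proof -
  have "summable (\<lambda>k. \<bar>if k = n then 1 else 0 :: real\<bar>)"
    by (rule summable_finite[of "{n}"]) auto
  then show ?thesis unfolding ell1_unit_def by (subst Abs_ell1_inverse) auto
qed

lemma norm_ell1_unit: "norm (ell1_unit n) = 1"
proof -
  have "(\<lambda>k. \<bar>ell1_seq (ell1_unit n) k\<bar>) sums (\<Sum>k\<in>{n}. \<bar>ell1_seq (ell1_unit n) k\<bar>)"
    by (rule sums_finite) (auto simp: ell1_seq_unit)
  from sums_unique2[OF norm_ell1_sums this] show ?thesis by (simp add: ell1_seq_unit)
qed

text \<open>The limit is taken coordinatewise. The estimate \<open>close\<close> is uniform in the
  cut-off \<open>K\<close>, so it yields both the summability of the limit and convergence in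
  norm.\<close>

lemma complete_ell1: "complete (UNIV :: ell1 set)"
  unfolding complete_def
proof (intro allI impI, elim conjE)
  fix X :: "nat \<Rightarrow> ell1" assume "Cauchy X"
  have "Cauchy (\<lambda>n. ell1_seq (X n) k)" for k
    using bounded_linear.Cauchy[OF bounded_linear_ell1_seq \<open>Cauchy X\<close>] .
  then have "\<forall>k. \<exists>l. (\<lambda>n. ell1_seq (X n) k) \<longlonglongrightarrow> l"
    using real_Cauchy_convergent unfolding convergent_def by blast
  from choice[OF this] obtain f where f: "\<And>k. (\<lambda>n. ell1_seq (X n) k) \<longlonglongrightarrow> f k"
    by blast
  have close: "\<exists>N. \<forall>n\<ge>N. \<forall>K. (\<Sum>k<K. \<bar>f k - ell1_seq (X n) k\<bar>) \<le> \<epsilon>" if "\<epsilon> > 0" for \<epsilon> :: real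
  proof -
    obtain N where N: "\<forall>m\<ge>N. \<forall>n\<ge>N. norm (X m - X n) < \<epsilon>"
      using CauchyD[OF \<open>Cauchy X\<close> \<open>\<epsilon> > 0\<close>] by blast
    have "(\<Sum>k<K. \<bar>f k - ell1_seq (X n) k\<bar>) \<le> \<epsilon>" if "n \<ge> N" for n K
    proof (rule LIMSEQ_le_const2)
      show "(\<lambda>m. \<Sum>k<K. \<bar>ell1_seq (X m) k - ell1_seq (X n) k\<bar>)
          \<longlonglongrightarrow> (\<Sum>k<K. \<bar>f k - ell1_seq (X n) k\<bar>)"
        by (intro tendsto_intros f)
      have "(\<Sum>k<K. \<bar>ell1_seq (X m) k - ell1_seq (X n) k\<bar>) \<le> \<epsilon>" if "m \<ge> N" for m
        using sum_ell1_seq_le_norm[of "{..<K}" "X m - X n"] N[rule_format, OF that \<open>n \<ge> N\<close>]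
        by (simp add: minus_ell1.rep_eq)
      then show "\<exists>M. \<forall>m\<ge>M. (\<Sum>k<K. \<bar>ell1_seq (X m) k - ell1_seq (X n) k\<bar>) \<le> \<epsilon>" by blast
    qed
    then show ?thesis by blast
  qed
  obtain N where N: "\<And>K. (\<Sum>k<K. \<bar>f k - ell1_seq (X N) k\<bar>) \<le> 1"
    using close[of 1] by auto
  have "summable (\<lambda>k. \<bar>f k - ell1_seq (X N) k\<bar>)"
    by (rule summableI_nonneg_bounded[of _ 1]) (auto simp: N)
  then have "summable (\<lambda>k. \<bar>(f k - ell1_seq (X N) k) + ell1_seq (X N) k\<bar>)"
    using summable_ell1_seq by (rule ell1_summable_add)
  then have seqf: "ell1_seq (Abs_ell1 f) = f"
    by (simp add: Abs_ell1_inverse)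
  have "X \<longlonglongrightarrow> Abs_ell1 f"
  proof (rule LIMSEQ_I)
    fix r :: real assume "r > 0"
    then obtain N where N: "\<And>n K. n \<ge> N \<Longrightarrow> (\<Sum>k<K. \<bar>f k - ell1_seq (X n) k\<bar>) \<le> r / 2"
      using close[of "r / 2"] by auto
    have "norm (X n - Abs_ell1 f) < r" if "n \<ge> N" for n
    proof -
      have "norm (Abs_ell1 f - X n) \<le> r / 2"
        unfolding norm_ell1.rep_eq
        using N[OF that] summable_ell1_seq[of "Abs_ell1 f - X n"]
        by (intro suminf_le_const) (auto simp: minus_ell1.rep_eq seqf)
      then show ?thesis using \<open>r > 0\<close> by (simp add: norm_minus_commute)
    qed
    then show "\<exists>N. \<forall>n\<ge>N. norm (X n - Abs_ell1 f) < r" by blast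
  qed
  then show "\<exists>l\<in>UNIV. X \<longlonglongrightarrow> l" by blast
qed

lemma scaled_unit_in_span:
  fixes S :: "'a::real_normed_vector set"
  assumes "f \<in> span S" "f \<noteq> 0"
  shows "inverse (norm f) *\<^sub>R f \<in> span S" "norm (inverse (norm f) *\<^sub>R f) = 1"
  using assms by (auto intro: span_mul)

text \<open>On a unit vector the partial sums increase to 1 > \<open>r\<close>, so Dini's principle
  applies on the sphere and homogeneity does the rest. All of \<open>span S\<close> is thus
  essentially supported on the first \<open>n\<close> coordinates.\<close>

lemma ell1_span_partial_sums:
  fixes S :: "ell1 set"
  assumes S: "finite S" and "r < 1"
  obtains n where "\<And>f. f \<in> span S \<Longrightarrow> r * norm f \<le> (\<Sum>k<n. \<bar>ell1_seq f k\<bar>)"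
proof -
  define U where "U n = {f. r < (\<Sum>k<n. \<bar>ell1_seq f k\<bar>)}" for n
  have "open (U n)" for n
    unfolding U_def by (intro open_Collect_less continuous_intros)
  moreover have "U m \<subseteq> U n" if "m \<le> n" for m n
  proof -
    have "(\<Sum>k<m. \<bar>ell1_seq f k\<bar>) \<le> (\<Sum>k<n. \<bar>ell1_seq f k\<bar>)" for f
      using that by (intro sum_mono2) auto
    then show ?thesis unfolding U_def by (auto intro: less_le_trans)
  qed
  moreover have "\<exists>n. f \<in> U n" if "norm f = 1" for f
    using ell1_partial_sum_gt[of r f] that \<open>r < 1\<close> by (auto simp: U_def)
  ultimately obtain n where n: "\<And>f. f \<in> span S \<Longrightarrow> norm f = 1 \<Longrightarrow> f \<in> U n"
    using uniform_on_unit_sphere_span[OF S, of U] by blast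
  have "r * norm f \<le> (\<Sum>k<n. \<bar>ell1_seq f k\<bar>)" if f: "f \<in> span S" for f
  proof (cases "f = 0")
    case False
    have "r < (\<Sum>k<n. \<bar>ell1_seq (inverse (norm f) *\<^sub>R f) k\<bar>)"
      using n[OF scaled_unit_in_span[OF f False]] by (simp add: U_def)
    also have "\<dots> = inverse (norm f) * (\<Sum>k<n. \<bar>ell1_seq f k\<bar>)"
      by (simp add: scaleR_ell1.rep_eq abs_mult sum_distrib_left)
    finally show ?thesis using False by (simp add: field_simps)
  qed (simp add: zero_ell1.rep_eq)
  then show thesis by (rule that)
qed

text \<open>The octahedral direction is a unit vector just beyond the essential support of the span,
  where every \<open>f\<close> has at most \<open>\<epsilon> / 2\<close> of its norm.\<close>

lemma octahedral_ell1: "octahedral_on (UNIV :: ell1 set)"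
  unfolding octahedral_on_def
proof (intro allI impI, elim conjE)
  fix S :: "ell1 set" and \<epsilon> :: real
  assume S: "finite S" and \<epsilon>: "\<epsilon> > 0"
  then obtain n where n: "\<And>f. f \<in> span S \<Longrightarrow> (1 - \<epsilon> / 2) * norm f \<le> (\<Sum>k<n. \<bar>ell1_seq f k\<bar>)"
    using ell1_span_partial_sums[of S "1 - \<epsilon> / 2"] by auto
  have coord: "\<bar>ell1_seq f n\<bar> \<le> \<epsilon> / 2 * norm f" if f: "f \<in> span S" for f
    using n[OF f] sum_ell1_seq_le_norm[of "{..<Suc n}" f] by (simp add: algebra_simps)
  have "(1 - \<epsilon>) * (norm f + \<bar>c\<bar>) \<le> norm (f + c *\<^sub>R ell1_unit n)" if f: "f \<in> span S" for f c
  proof -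
    \<comment> \<open>At coordinate \<open>n\<close> the triangle inequality gives |f_n + c| >= |c|
      - |f_n| = |f_n| + (|c| - 2 |f_n|); all other coordinates are unchanged.\<close>
    have "(\<lambda>k. \<bar>ell1_seq f k\<bar> + (if k = n then \<bar>c\<bar> - 2 * \<bar>ell1_seq f n\<bar> else 0))
        sums (norm f + (\<bar>c\<bar> - 2 * \<bar>ell1_seq f n\<bar>))"
      by (intro sums_add norm_ell1_sums sums_single)
    then have "norm f + (\<bar>c\<bar> - 2 * \<bar>ell1_seq f n\<bar>) \<le> norm (f + c *\<^sub>R ell1_unit n)"
      by (rule sums_le[OF _ _ norm_ell1_sums, rotated])
         (auto simp: plus_ell1.rep_eq scaleR_ell1.rep_eq ell1_seq_unit)
    moreover have "\<epsilon> * \<bar>c\<bar> \<ge> 0" using \<epsilon> by simp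
    ultimately show ?thesis using coord[OF f] by (simp add: algebra_simps)
  qed
  then show "\<exists>x\<in>UNIV. norm x = 1 \<and>
      (\<forall>f\<in>span S. \<forall>c. (1 - \<epsilon>) * (norm f + \<bar>c\<bar>) \<le> norm (f + c *\<^sub>R x))"
    using norm_ell1_unit by blast
qed

section \<open>Uniform smoothness and the dual basis\<close>

lemma blinfun_norming:
  fixes F :: "'a::real_normed_vector \<Rightarrow>\<^sub>L 'b::real_normed_vector"
  assumes "r < norm F" "0 \<le> r"
  obtains x where "norm x = 1" "r < norm (F x)"
proof -
  have "\<exists>x. r * norm x < norm (F x)"
  proof (rule ccontr)
    assume "\<not> ?thesis"
    then have "norm F \<le> r" using \<open>0 \<le> r\<close> by (intro norm_blinfun_bound) (auto simp: not_less)
    with assms show False by simp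
  qed
  then obtain x where x: "r * norm x < norm (F x)" by blast
  then have "x \<noteq> 0" by auto
  then show thesis
    using x by (intro that[of "inverse (norm x) *\<^sub>R x"]) (auto simp: blinfun.scaleR_right field_simps)
qed

lemma functional_norming:
  fixes \<phi> :: "'a::real_normed_vector \<Rightarrow>\<^sub>L real"
  assumes "r < norm \<phi>" "0 \<le> r"
  obtains x where "norm x = 1" "r < \<phi> x"
proof -
  obtain x where x: "norm x = 1" "r < \<bar>\<phi> x\<bar>"
    using blinfun_norming[OF assms] by (metis real_norm_def)
  show thesis
  proof (cases "\<phi> x \<ge> 0")
    case True
    then show ?thesis using x that[of x] by simp
  next
    case False
    then show ?thesis using x that[of "- x"] by (simp add: blinfun.minus_right)
  qed
qed

lemma functional_le_norm:
  fixes \<phi> :: "'a::real_normed_vector \<Rightarrow>\<^sub>L real"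
  assumes "norm \<phi> \<le> 1"
  shows "\<phi> x \<le> norm x"
proof -
  have "norm (\<phi> x) \<le> norm \<phi> * norm x" by (rule norm_blinfun)
  also have "\<dots> \<le> 1 * norm x" using assms by (intro mult_right_mono) auto
  finally show ?thesis by simp
qed

text \<open>If \<open>\<phi> - \<psi>\<close> exceeds \<open>\<epsilon>\<close> at a unit vector
  \<open>y\<close>, then \<open>\<phi> (x + \<tau> *\<^sub>R y) + \<psi> (x - \<tau> *\<^sub>R
  y)\<close> gains \<open>\<tau> * \<epsilon>\<close> over \<open>\<phi> x + \<psi> x\<close>, which
  is close to 2; smoothness allows only half of that gain.\<close>

lemma uniformly_smooth_dual_slices:
  assumes "uniformly_smooth TYPE('y::real_normed_vector)" and "\<epsilon> > 0"
  obtains \<eta> where "\<eta> > 0"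
    and "\<And>\<phi> \<psi> x. norm (\<phi> :: 'y \<Rightarrow>\<^sub>L real) \<le> 1 \<Longrightarrow> norm (\<psi> :: 'y \<Rightarrow>\<^sub>L real) \<le> 1 \<Longrightarrow> norm x = 1 \<Longrightarrow>
      1 - \<eta> < \<phi> x \<Longrightarrow> 1 - \<eta> < \<psi> x \<Longrightarrow> norm (\<phi> - \<psi>) \<le> \<epsilon>"
proof -
  have "\<epsilon> / 2 > 0" using \<open>\<epsilon> > 0\<close> by simp
  then obtain \<delta> where "\<delta> > 0" and \<delta>: "\<forall>(x::'y) y \<tau>. norm x = 1 \<and> norm y = 1 \<and> 0 < \<tau> \<and> \<tau> < \<delta> \<longrightarrow>
      norm (x + \<tau> *\<^sub>R y) + norm (x - \<tau> *\<^sub>R y) \<le> 2 + \<epsilon> / 2 * \<tau>"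
    using assms(1) unfolding uniformly_smooth_def by blast
  define \<tau> where "\<tau> = \<delta> / 2"
  have \<tau>: "0 < \<tau>" "\<tau> < \<delta>" using \<open>\<delta> > 0\<close> by (auto simp: \<tau>_def)
  show thesis
  \<comment> \<open>The two functionals together lose at most \<open>\<tau> * \<epsilon> / 2\<close>
    at \<open>x\<close>; with the gain \<open>\<tau> * \<epsilon>\<close> the sum still exceeds the
    smoothness bound \<open>2 + \<epsilon> / 2 * \<tau>\<close>.\<close>
  proof (rule that[of "\<tau> * \<epsilon> / 4"])
    show "\<tau> * \<epsilon> / 4 > 0" using \<tau> assms by simp
    fix \<phi> \<psi> :: "'y \<Rightarrow>\<^sub>L real" and x
    assume n: "norm \<phi> \<le> 1" "norm \<psi> \<le> 1" "norm x = 1"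
      and x: "1 - \<tau> * \<epsilon> / 4 < \<phi> x" "1 - \<tau> * \<epsilon> / 4 < \<psi> x"
    show "norm (\<phi> - \<psi>) \<le> \<epsilon>"
    proof (rule ccontr)
      assume "\<not> ?thesis"
      then obtain y where y: "norm y = 1" "\<epsilon> < (\<phi> - \<psi>) y"
        using functional_norming[of \<epsilon> "\<phi> - \<psi>"] assms by auto
      have "\<phi> x + \<psi> x + \<tau> * (\<phi> - \<psi>) y = \<phi> (x + \<tau> *\<^sub>R y) + \<psi> (x - \<tau> *\<^sub>R y)"
        by (simp add: blinfun.add_right blinfun.diff_right blinfun.scaleR_right blinfun.diff_left algebra_simps)
      also have "\<dots> \<le> norm (x + \<tau> *\<^sub>R y) + norm (x - \<tau> *\<^sub>R y)"
        by (intro add_mono functional_le_norm n)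
      also have "\<dots> \<le> 2 + \<epsilon> / 2 * \<tau>" using \<delta> n y \<tau> by blast
      moreover have "\<tau> * \<epsilon> < \<tau> * (\<phi> - \<psi>) y" using y \<tau> by simp
      ultimately show False using x by (simp add: algebra_simps)
    qed
  qed
qed

text \<open>The operators \<open>Q n\<close> are the adjoints of the basis projections; \<open>Q_tendsto\<close> says
  that the basis is shrinking.\<close>

locale shrinking_monotone_basis =
  fixes e :: "nat \<Rightarrow> 'y::real_normed_vector" and a :: "nat \<Rightarrow> ('y \<Rightarrow>\<^sub>L real)"
  assumes biorthogonal: "a i (e j) = (if i = j then 1 else 0)"
    and norm_Q_le': "norm (\<Sum>i<n. blinfun_apply \<phi> (e i) *\<^sub>R a i) \<le> norm \<phi>"
    and Q_tendsto': "(\<lambda>n. \<Sum>i<n. blinfun_apply \<phi> (e i) *\<^sub>R a i) \<longlonglongrightarrow> \<phi>"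
begin

definition Q :: "nat \<Rightarrow> ('y \<Rightarrow>\<^sub>L real) \<Rightarrow> ('y \<Rightarrow>\<^sub>L real)" where
  "Q n \<phi> = (\<Sum>i<n. \<phi> (e i) *\<^sub>R a i)"

lemma norm_Q_le: "norm (Q n \<phi>) \<le> norm \<phi>"
  unfolding Q_def by (rule norm_Q_le')

lemma Q_tendsto: "(\<lambda>n. Q n \<phi>) \<longlonglongrightarrow> \<phi>"
  unfolding Q_def by (rule Q_tendsto')

lemma sum_apply_e: "(\<Sum>i<n. c i *\<^sub>R a i) (e j) = (if j < n then c j else 0)"
proof -
  have "(\<Sum>i<n. c i *\<^sub>R a i) (e j) = (\<Sum>i<n. c i * (if i = j then 1 else 0))"
    by (simp add: blinfun.sum_left blinfun.scaleR_left biorthogonal)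
  also have "\<dots> = (\<Sum>i<n. if i = j then c i else 0)" by (intro sum.cong) auto
  finally show ?thesis by simp
qed

lemma Q_Q: "m \<le> n \<Longrightarrow> Q n (Q m \<phi>) = Q m \<phi>"
proof -
  assume "m \<le> n"
  have "Q n (Q m \<phi>) = (\<Sum>i<n. (if i < m then \<phi> (e i) else 0) *\<^sub>R a i)"
    unfolding Q_def sum_apply_e ..
  also have "\<dots> = Q m \<phi>" unfolding Q_def
    using \<open>m \<le> n\<close> by (intro sum.mono_neutral_cong_right) auto
  finally show ?thesis .
qed

end

text \<open>\<open>Q n \<phi>\<close> is \<open>\<phi>\<close> composed with the n-th basis
  projection. At a vector almost norming \<open>\<phi>\<close> its values converge to those of
  \<open>\<phi>\<close>, and monotonicity keeps it in the unit ball, so eventually both lie in one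
  small slice and are close in norm.\<close>

lemma shrinking_monotone_basisI:
  fixes e :: "nat \<Rightarrow> 'y::real_normed_vector"
  assumes smooth: "uniformly_smooth TYPE('y)" and "monotone_schauder_basis e"
  obtains a where "shrinking_monotone_basis e a"
proof -
  have basis: "\<And>y. \<exists>!c. (\<lambda>n. \<Sum>i<n. c i *\<^sub>R e i) \<longlonglongrightarrow> y"
    and mono: "\<And>y c n. (\<lambda>m. \<Sum>i<m. c i *\<^sub>R e i) \<longlonglongrightarrow> y \<Longrightarrow> norm (\<Sum>i<n. c i *\<^sub>R e i) \<le> norm y"
    using assms unfolding monotone_schauder_basis_def schauder_basis_def by blast+
  define C where "C y = (THE c. (\<lambda>n. \<Sum>i<n. c i *\<^sub>R e i) \<longlonglongrightarrow> y)" for y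
  have C: "(\<lambda>n. \<Sum>i<n. C y i *\<^sub>R e i) \<longlonglongrightarrow> y" for y
    unfolding C_def by (rule theI'[OF basis])
  have C_eqI: "C y = c" if "(\<lambda>n. \<Sum>i<n. c i *\<^sub>R e i) \<longlonglongrightarrow> y" for y c
    using basis[of y] C that by blast
  have C_add: "C (x + y) = (\<lambda>i. C x i + C y i)" for x y
    using tendsto_add[OF C C, of x y]
    by (intro C_eqI) (simp add: scaleR_add_left sum.distrib)
  have C_scale: "C (r *\<^sub>R y) = (\<lambda>i. r * C y i)" for r y
    using tendsto_scaleR[OF tendsto_const C, of r y]
    by (intro C_eqI) (simp add: scaleR_sum_right)
  have C_e: "C (e j) = (\<lambda>i. if i = j then 1 else 0)" for j
  proof (rule C_eqI, rule tendsto_eventually)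
    have "(\<Sum>i<n. (if i = j then 1 else 0) *\<^sub>R e i) = e j" if "n > j" for n
    proof -
      have "(\<Sum>i<n. (if i = j then 1 else 0) *\<^sub>R e i) = (\<Sum>i<n. if i = j then e i else 0)"
        by (intro sum.cong) auto
      then show ?thesis using that by simp
    qed
    then show "\<forall>\<^sub>F n in sequentially. (\<Sum>i<n. (if i = j then 1 else 0) *\<^sub>R e i) = e j"
      using eventually_gt_at_top[of j] by (rule eventually_mono[rotated])
  qed
  have C_0: "C 0 = (\<lambda>i. 0)" using C_scale[of 0 0] by simp
  have e_nz: "e j \<noteq> 0" for j
    using C_e[of j] C_0 by (auto dest: fun_cong[of _ _ j])
  \<comment> \<open>Continuity of the coefficient functionals: each term is a difference of two
    consecutive partial sums, and monotonicity bounds both by \<open>norm y\<close>.\<close>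
  have C_bound: "\<bar>C y i\<bar> \<le> norm y * 2 / norm (e i)" for y i
  proof -
    have "C y i *\<^sub>R e i = (\<Sum>k<Suc i. C y k *\<^sub>R e k) - (\<Sum>k<i. C y k *\<^sub>R e k)" by simp
    then have "norm (C y i *\<^sub>R e i) \<le> norm (\<Sum>k<Suc i. C y k *\<^sub>R e k) + norm (\<Sum>k<i. C y k *\<^sub>R e k)"
      using norm_triangle_ineq4 by metis
    also have "\<dots> \<le> norm y + norm y" by (intro add_mono mono C)
    finally show ?thesis using e_nz by (simp add: field_simps)
  qed
  define a where "a i = Blinfun (\<lambda>y. C y i)" for i
  have a: "a i y = C y i" for i y
  proof -
    have "bounded_linear (\<lambda>y. C y i)"
      by (rule bounded_linear_intro[of _ "2 / norm (e i)"]) (auto simp: C_add C_scale C_bound)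
    then show ?thesis by (simp add: a_def bounded_linear_Blinfun_apply)
  qed
  define Q where "Q n \<phi> = (\<Sum>i<n. \<phi> (e i) *\<^sub>R a i)" for n and \<phi> :: "'y \<Rightarrow>\<^sub>L real"
  have Q: "Q n \<phi> y = \<phi> (\<Sum>i<n. C y i *\<^sub>R e i)" for n \<phi> y
    by (simp add: Q_def blinfun.sum_left blinfun.scaleR_left a blinfun.sum_right blinfun.scaleR_right
        mult.commute)
  have norm_Q: "norm (Q n \<phi>) \<le> norm \<phi>" for n \<phi>
  proof (rule norm_blinfun_bound)
    fix y
    have "norm (Q n \<phi> y) \<le> norm \<phi> * norm (\<Sum>i<n. C y i *\<^sub>R e i)"
      unfolding Q by (rule norm_blinfun)
    also have "\<dots> \<le> norm \<phi> * norm y" by (intro mult_left_mono mono C) auto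
    finally show "norm (Q n \<phi> y) \<le> norm \<phi> * norm y" .
  qed simp
  have Q_lim1: "(\<lambda>n. Q n \<phi>) \<longlonglongrightarrow> \<phi>" if "norm \<phi> = 1" for \<phi>
  proof (rule LIMSEQ_I)
    fix r :: real assume "r > 0"
    obtain \<eta> where "\<eta> > 0" and \<eta>: "\<And>\<phi> \<psi> x. norm (\<phi> :: 'y \<Rightarrow>\<^sub>L real) \<le> 1 \<Longrightarrow> norm (\<psi> :: 'y \<Rightarrow>\<^sub>L real) \<le> 1 \<Longrightarrow> norm x = 1 \<Longrightarrow>
      1 - \<eta> < \<phi> x \<Longrightarrow> 1 - \<eta> < \<psi> x \<Longrightarrow> norm (\<phi> - \<psi>) \<le> r / 2"
      using uniformly_smooth_dual_slices[OF smooth, of "r / 2"] \<open>r > 0\<close> by auto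
    \<comment> \<open>Clipped at 0 because \<open>functional_norming\<close> requires a nonnegative
      threshold.\<close>
    have "max 0 (1 - \<eta>) < norm \<phi>" using \<open>\<eta> > 0\<close> \<open>norm \<phi> = 1\<close> by simp
    then obtain x where x: "norm x = 1" "max 0 (1 - \<eta>) < \<phi> x"
      by (rule functional_norming) auto
    have "(\<lambda>n. Q n \<phi> x) \<longlonglongrightarrow> \<phi> x"
      unfolding Q by (intro blinfun.tendsto tendsto_const C)
    then have "\<forall>\<^sub>F n in sequentially. 1 - \<eta> < Q n \<phi> x"
      using x(2) by (intro order_tendstoD(1)) auto
    then obtain N where "\<forall>n\<ge>N. 1 - \<eta> < Q n \<phi> x" unfolding eventually_sequentially by blast
    then have "norm (Q n \<phi> - \<phi>) < r" if "n \<ge> N" for n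
      using \<eta>[of "Q n \<phi>" \<phi> x] that x norm_Q[of n \<phi>] \<open>norm \<phi> = 1\<close> \<open>r > 0\<close> by auto
    then show "\<exists>N. \<forall>n\<ge>N. norm (Q n \<phi> - \<phi>) < r" by blast
  qed
  have Q_scale: "Q n (c *\<^sub>R \<phi>) = c *\<^sub>R Q n \<phi>" for n c \<phi>
    by (simp add: Q_def scaleR_sum_right blinfun.scaleR_left)
  have Q_lim: "(\<lambda>n. Q n \<phi>) \<longlonglongrightarrow> \<phi>" for \<phi>
  proof (cases "\<phi> = 0")
    case True
    then show ?thesis by (simp add: Q_def)
  next
    case False
    then have "(\<lambda>n. norm \<phi> *\<^sub>R Q n (inverse (norm \<phi>) *\<^sub>R \<phi>)) \<longlonglongrightarrow> norm \<phi> *\<^sub>R (inverse (norm \<phi>) *\<^sub>R \<phi>)"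
      by (intro tendsto_scaleR tendsto_const Q_lim1) simp
    then show ?thesis using False by (simp add: Q_scale)
  qed
  have "shrinking_monotone_basis e a"
    using norm_Q Q_lim by unfold_locales (auto simp: a C_e Q_def)
  then show thesis by (rule that)
qed

section \<open>From finite representability to octahedral operator spaces\<close>

text \<open>Finite representability provides maps that are linear on a span only; extending them
  makes the theory of \<open>linear\<close> maps available.\<close>

lemma linear_extension_from_span:
  fixes T :: "'a::real_vector \<Rightarrow> 'b::real_vector"
  assumes add: "\<And>f g. f \<in> span S \<Longrightarrow> g \<in> span S \<Longrightarrow> T (f + g) = T f + T g"
    and scale: "\<And>c f. f \<in> span S \<Longrightarrow> T (c *\<^sub>R f) = c *\<^sub>R T f"
  obtains T' where "linear T'" "\<And>f. f \<in> span S \<Longrightarrow> T' f = T f"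
proof -
  obtain B where B: "B \<subseteq> span S" "independent B" "span S \<subseteq> span B"
    by (rule maximal_independent_subset)
  obtain T' where T': "linear T'" "\<And>b. b \<in> B \<Longrightarrow> T' b = T b"
    using linear_independent_extend[OF B(2), of T] by blast
  have BS: "span B = span S"
    using B span_minimal[OF B(1) subspace_span] by blast
  have T0: "T 0 = 0" using scale[of 0 0] by (simp add: span_zero)
  have "T' f = T f \<and> f \<in> span S" if "f \<in> span B" for f
    using that
  proof (induction rule: span_induct_alt)
    case base
    then show ?case using T0 linear_0[OF T'(1)] span_zero by simp
  next
    case (step c b f)
    have b: "b \<in> span S" using step B by blast
    then have "c *\<^sub>R b \<in> span S" by (rule span_mul)
    then show ?case
      using step b by (simp add: linear_add[OF T'(1)] linear_scale[OF T'(1)] add scale T'(2) span_add)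
  qed
  then show thesis using T'(1) BS that by blast
qed

text \<open>The definition controls only the ratio of the two constants. A rescaling turns the map
  into a contraction on the span, and the whole loss goes into the lower bound.\<close>

lemma fin_rep_ell1_linear:
  fixes S :: "'z::real_normed_vector set"
  assumes rep: "fin_rep_ell1 TYPE('z)" and "finite S" and r: "0 < r" "r < 1"
  obtains T :: "'z \<Rightarrow> ell1" where "linear T"
    and "\<And>f. f \<in> span S \<Longrightarrow> r * norm f \<le> norm (T f)"
    and "\<And>f. f \<in> span S \<Longrightarrow> norm (T f) \<le> norm f"
proof -
  \<comment> \<open>Chosen so that the admissible upper constant \<open>(1 + \<epsilon>) * m\<close>
    equals \<open>m / r\<close>.\<close>
  define \<epsilon> where "\<epsilon> = 1 / r - 1"
  have "\<epsilon> > 0" using r by (simp add: \<epsilon>_def field_simps)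
  obtain T0 :: "'z \<Rightarrow> ell1" and m M where
    T0: "\<forall>f\<in>span S. \<forall>g\<in>span S. T0 (f + g) = T0 f + T0 g"
      "\<forall>f\<in>span S. \<forall>c. T0 (c *\<^sub>R f) = c *\<^sub>R T0 f"
    and mM: "0 < m" "M \<le> (1 + \<epsilon>) * m"
    and bd: "\<forall>f\<in>span S. m * norm f \<le> norm (T0 f) \<and> norm (T0 f) \<le> M * norm f"
    using rep[unfolded fin_rep_ell1_def, rule_format, OF conjI, OF \<open>finite S\<close> \<open>\<epsilon> > 0\<close>] by blast
  obtain T where T: "linear T" "\<And>f. f \<in> span S \<Longrightarrow> T f = T0 f"
    using linear_extension_from_span[of S T0] T0 by blast
  \<comment> \<open>\<open>M\<close> may fail to be positive when the span is trivial, so the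
    division is by this larger constant.\<close>
  define M' where "M' = m / r"
  have "M' > 0" using mM r by (simp add: M'_def)
  have "M \<le> M'" using mM r by (simp add: M'_def \<epsilon>_def)
  show thesis
  proof (rule that[of "\<lambda>f. inverse M' *\<^sub>R T f"])
    show "linear (\<lambda>f. inverse M' *\<^sub>R T f)"
      by (rule linear_compose_scale_right[OF T(1)])
    fix f assume f: "f \<in> span S"
    show "r * norm f \<le> norm (inverse M' *\<^sub>R T f)"
      using bd f mM r by (simp add: T(2)[OF f] M'_def field_simps)
    have "norm (T0 f) \<le> M' * norm f"
      using bd f mult_right_mono[OF \<open>M \<le> M'\<close> norm_ge_zero, of f] by fastforce
    then show "norm (inverse M' *\<^sub>R T f) \<le> norm f"
      using \<open>M' > 0\<close> by (simp add: T(2)[OF f] field_simps)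
  qed
qed

lemma octahedral_onD:
  fixes H :: "'a::real_normed_vector set"
  assumes "octahedral_on H" "finite S" "S \<subseteq> H" "\<epsilon> > 0"
  shows "\<exists>x\<in>H. norm x = 1 \<and>
    (\<forall>f\<in>span S. \<forall>c. (1 - \<epsilon>) * (norm f + \<bar>c\<bar>) \<le> norm (f + c *\<^sub>R x))"
  using assms(1)[unfolded octahedral_on_def, rule_format, of S \<epsilon>] assms(2-4) by simp

text \<open>Each new vector is chosen octahedral over the span of \<open>S\<close> and of the
  earlier ones. The result is a copy of the ell_1 unit vectors that also adds up in norm with
  \<open>span S\<close>. Only the first \<open>m\<close> entries carry information; the others are
  0.\<close>

lemma octahedral_ell1_sequence:
  fixes S :: "'x::real_normed_vector set"
  assumes oct: "octahedral_on (UNIV :: 'x set)" and S: "finite S" and "r < 1"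
  shows "\<exists>x::nat \<Rightarrow> 'x. (\<forall>k. norm (x k) \<le> 1) \<and>
    (\<forall>f\<in>span S. \<forall>c. r * (norm f + (\<Sum>k<m. \<bar>c k\<bar>)) \<le> norm (f + (\<Sum>k<m. c k *\<^sub>R x k)))"
  using \<open>r < 1\<close>
proof (induction m arbitrary: r)
  case 0
  then have "r * norm f \<le> norm f" for f :: 'x
    using mult_right_mono[of r 1 "norm f"] by simp
  then show ?case by (intro exI[of _ "\<lambda>_. 0"]) simp
next
  case (Suc m)
  \<comment> \<open>The induction hypothesis and the new vector each cost a factor \<open>s\<close>,
    and \<open>r \<le> s * s\<close> is the inequality of arithmetic and geometric means for 1 and
    \<open>r\<close>; the maximum covers negative \<open>r\<close>.\<close>
  define s where "s = max ((1 + r) / 2) 0"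
  have s: "s < 1" "0 \<le> s" using Suc.prems by (auto simp: s_def)
  have "r \<le> ((1 + r) / 2)\<^sup>2"
    using zero_le_power2[of "1 - r"] by (simp add: power2_eq_square field_simps)
  then have "r \<le> s * s" if "r \<ge> -1"
    using that by (simp add: s_def max_absorb1 power2_eq_square)
  then have rs: "r \<le> s * s" using s by (cases "r \<ge> -1") (auto simp: not_le intro: order_trans[of _ 0])
  obtain x where x1: "\<And>k. norm (x k) \<le> 1"
    and x: "\<And>f c. f \<in> span S \<Longrightarrow> s * (norm f + (\<Sum>k<m. \<bar>c k\<bar>)) \<le> norm (f + (\<Sum>k<m. c k *\<^sub>R x k))"
    using Suc.IH[OF s(1)] by blast
  have "finite (S \<union> x ` {..<m})" "1 - s > 0" using S s by auto
  from octahedral_onD[OF oct this(1) subset_UNIV this(2)]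
  obtain u where u1: "norm u = 1" and
    u: "\<forall>f\<in>span (S \<union> x ` {..<m}). \<forall>c. (1 - (1 - s)) * (norm f + \<bar>c\<bar>) \<le> norm (f + c *\<^sub>R u)"
    by blast
  define x' where "x' = x(m := u)"
  have "r * (norm f + (\<Sum>k<Suc m. \<bar>c k\<bar>)) \<le> norm (f + (\<Sum>k<Suc m. c k *\<^sub>R x' k))"
    if f: "f \<in> span S" for f c
  proof -
    let ?g = "f + (\<Sum>k<m. c k *\<^sub>R x k)"
    have "f \<in> span (S \<union> x ` {..<m})" using f span_mono[of S "S \<union> x ` {..<m}"] by blast
    moreover have "(\<Sum>k<m. c k *\<^sub>R x k) \<in> span (S \<union> x ` {..<m})"
      by (intro span_sum span_mul span_base) auto
    ultimately have g: "?g \<in> span (S \<union> x ` {..<m})" by (rule span_add)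
    have "r * (norm f + (\<Sum>k<Suc m. \<bar>c k\<bar>)) \<le> (s * s) * (norm f + (\<Sum>k<Suc m. \<bar>c k\<bar>))"
      by (intro mult_right_mono rs add_nonneg_nonneg sum_nonneg) auto
    also have "\<dots> = s * (s * (norm f + (\<Sum>k<m. \<bar>c k\<bar>)) + s * \<bar>c m\<bar>)"
      by (simp add: algebra_simps)
    also have "\<dots> \<le> s * (norm ?g + 1 * \<bar>c m\<bar>)"
      using s by (intro mult_left_mono add_mono mult_right_mono x f) auto
    also have "\<dots> \<le> norm (?g + c m *\<^sub>R u)" using u[rule_format, OF g, of "c m"] by simp
    also have "?g + c m *\<^sub>R u = f + (\<Sum>k<Suc m. c k *\<^sub>R x' k)"
      by (simp add: x'_def add.assoc)
    finally show ?thesis .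
  qed
  moreover have "norm (x' k) \<le> 1" for k using x1 u1 by (simp add: x'_def)
  ultimately show ?case by blast
qed

text \<open>Everything is tested at a single \<open>\<psi>\<close> in the range of
  \<open>Q n\<close> that almost norms \<open>F\<close>. The values \<open>F \<psi>\<close> lie in
  the finite-dimensional \<open>span SX\<close>, over which the \<open>x k\<close> behave like ell_1
  unit vectors, so \<open>F \<psi>\<close> and \<open>c *\<^sub>R G0 \<psi>\<close> cannot cancel;
  and \<open>G0\<close> is nearly isometric on the range of \<open>Q n\<close>. It belongs to
  \<open>H\<close> because it has finite rank.\<close>

lemma (in shrinking_monotone_basis) octahedral_operators:
  fixes H :: "(('y \<Rightarrow>\<^sub>L real) \<Rightarrow>\<^sub>L 'x::real_normed_vector) set"
  assumes rep: "fin_rep_ell1 TYPE('y \<Rightarrow>\<^sub>L real)" and oct: "octahedral_on (UNIV :: 'x set)"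
    and H: "subspace H" "alg_tensor \<subseteq> H"
  shows "octahedral_on H"
  unfolding octahedral_on_def
proof (intro allI impI, elim conjE)
  fix S :: "(('y \<Rightarrow>\<^sub>L real) \<Rightarrow>\<^sub>L 'x) set" and \<epsilon> :: real
  assume S: "finite S" "S \<subseteq> H" and "\<epsilon> > 0"
  \<comment> \<open>At most three factors \<open>r\<close> are lost, and (1 - d)^3 >= 1 - 3 d; the
    cap at 1 keeps \<open>r\<close> positive.\<close>
  define d where "d = min \<epsilon> 1 / 3"
  define r where "r = 1 - d"
  have d: "0 < d" "d < 1" "3 * d \<le> \<epsilon>" using \<open>\<epsilon> > 0\<close> by (auto simp: d_def)
  have r: "0 < r" "r < 1" using d by (auto simp: r_def)
  have r3: "1 - \<epsilon> \<le> r * r * r"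
  proof -
    have "r * r * r = 1 - 3 * d + d * d * (3 - d)" by (simp add: r_def algebra_simps)
    moreover have "d * d * (3 - d) \<ge> 0" using d by (intro mult_nonneg_nonneg) auto
    ultimately show ?thesis using d by linarith
  qed
  define U where "U n = {F::('y \<Rightarrow>\<^sub>L real) \<Rightarrow>\<^sub>L 'x. \<exists>\<phi>. norm \<phi> \<le> 1 \<and> r < norm (F (Q n \<phi>))}" for n
  have U_open: "open (U n)" for n
  proof -
    have "U n = (\<Union>\<phi>\<in>{\<phi>. norm \<phi> \<le> 1}. {F. r < norm (blinfun_apply F (Q n \<phi>))})"
      by (auto simp: U_def)
    also have "open \<dots>" by (intro open_UN ballI open_Collect_less continuous_intros)
    finally show ?thesis .
  qed
  \<comment> \<open>A witness at stage \<open>m\<close> survives after being replaced by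
    \<open>Q m \<phi>\<close>, which \<open>Q n\<close> fixes.\<close>
  have U_mono: "U m \<subseteq> U n" if "m \<le> n" for m n
  proof
    fix F assume "F \<in> U m"
    then obtain \<phi> where "norm \<phi> \<le> 1" "r < norm (F (Q m \<phi>))" by (auto simp: U_def)
    then show "F \<in> U n"
      unfolding U_def using norm_Q_le[of m \<phi>] Q_Q[OF that, of \<phi>]
      by (intro CollectI exI[of _ "Q m \<phi>"]) auto
  qed
  have U_cover: "\<exists>n. F \<in> U n" if "norm F = 1" for F
  proof -
    obtain \<phi> where \<phi>: "norm \<phi> = 1" "r < norm (F \<phi>)"
      using blinfun_norming[of r F] r \<open>norm F = 1\<close> by auto
    have "(\<lambda>n. norm (F (Q n \<phi>))) \<longlonglongrightarrow> norm (F \<phi>)"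
      by (intro tendsto_norm blinfun.tendsto tendsto_const Q_tendsto)
    then have "\<forall>\<^sub>F n in sequentially. r < norm (F (Q n \<phi>))"
      using \<phi> by (intro order_tendstoD(1)) auto
    then obtain n where "r < norm (F (Q n \<phi>))" by (auto simp: eventually_sequentially)
    then have "F \<in> U n" using \<phi>(1) unfolding U_def by (intro CollectI exI[of _ \<phi>]) auto
    then show ?thesis ..
  qed
  obtain n0 where n0: "\<And>F. F \<in> span S \<Longrightarrow> norm F = 1 \<Longrightarrow> F \<in> U n0"
    using uniform_on_unit_sphere_span[OF S(1), of U] U_open U_mono U_cover by blast
  \<comment> \<open>The successor guarantees \<open>0 < n\<close>, so \<open>a 0\<close> lies in the
    range of \<open>Q n\<close>; this makes \<open>G0\<close> nonzero and normalisable.\<close>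
  define n where "n = Suc n0"
  have n: "F \<in> U n" if "F \<in> span S" "norm F = 1" for F
    using n0[OF that] U_mono[of n0 n] by (auto simp: n_def)
  obtain T :: "('y \<Rightarrow>\<^sub>L real) \<Rightarrow> ell1" where T: "linear T"
    and T_lower: "\<And>f. f \<in> span (a ` {..<n}) \<Longrightarrow> r * norm f \<le> norm (T f)"
    and T_upper: "\<And>f. f \<in> span (a ` {..<n}) \<Longrightarrow> norm (T f) \<le> norm f"
    using fin_rep_ell1_linear[OF rep _ r, of "a ` {..<n}"] by blast
  have Q_in: "Q n \<phi> \<in> span (a ` {..<n})" for \<phi>
    unfolding Q_def by (intro span_sum span_mul span_base) auto
  have TQ: "T (Q n \<phi>) = (\<Sum>i<n. blinfun_apply \<phi> (e i) *\<^sub>R T (a i))" for \<phi>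
    by (simp add: Q_def linear_sum[OF T] linear_scale[OF T])
  \<comment> \<open>Cutting the ell_1 images at \<open>m\<close> coordinates means that finitely
    many \<open>x k\<close> suffice.\<close>
  obtain m where m: "\<And>g. g \<in> span (T ` a ` {..<n}) \<Longrightarrow> r * norm g \<le> (\<Sum>k<m. \<bar>ell1_seq g k\<bar>)"
    using ell1_span_partial_sums[of "T ` a ` {..<n}" r] r by blast
  define SX where "SX = (\<Union>i\<in>{..<n}. (\<lambda>F. blinfun_apply F (a i)) ` S)"
  have "finite SX" unfolding SX_def using S by simp
  from octahedral_ell1_sequence[OF oct this r(2), of m]
  obtain x where x1: "\<forall>k. norm (x k) \<le> 1"
    and x: "\<forall>f\<in>span SX. \<forall>c. r * (norm f + (\<Sum>k<m. \<bar>c k\<bar>)) \<le> norm (f + (\<Sum>k<m. c k *\<^sub>R x k))"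
    by blast
  \<comment> \<open>\<open>G0\<close> is \<open>T \<circ> Q n\<close> with the unit vectors of \<open>\<ell>\<^sub>1\<close> replaced by the \<open>x k\<close>.\<close>
  define y where "y k = (\<Sum>i<n. ell1_seq (T (a i)) k *\<^sub>R e i)" for k
  \<comment> \<open>Each coordinate of \<open>T \<circ> Q n\<close> is the evaluation at a vector of
    \<open>'y\<close>, which is what puts \<open>G0\<close> into \<open>alg_tensor\<close>.\<close>
  have y: "blinfun_apply \<phi> (y k) = ell1_seq (T (Q n \<phi>)) k" for \<phi> k
    by (simp add: y_def TQ ell1_seq_sum scaleR_ell1.rep_eq blinfun.sum_right blinfun.scaleR_right mult.commute)
  define G0 where "G0 = Blinfun (\<lambda>\<phi>. \<Sum>k<m. blinfun_apply \<phi> (y k) *\<^sub>R x k)"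
  have G0: "G0 \<phi> = (\<Sum>k<m. \<phi> (y k) *\<^sub>R x k)" for \<phi>
  proof -
    have "bounded_linear (\<lambda>\<phi>. \<Sum>k<m. blinfun_apply \<phi> (y k) *\<^sub>R x k)"
      by (intro bounded_linear_sum bounded_linear_scaleR_const blinfun.bounded_linear_left)
    then show ?thesis by (simp add: G0_def bounded_linear_Blinfun_apply)
  qed
  have "G0 \<in> H" using H(2) G0 by (auto simp: alg_tensor_def)
  have norm_G0: "norm G0 \<le> 1"
  proof (rule norm_blinfun_bound)
    fix \<phi>
    have "norm (G0 \<phi>) \<le> (\<Sum>k<m. \<bar>\<phi> (y k)\<bar> * 1)"
      unfolding G0 by (rule sum_norm_le) (simp add: mult_left_le x1)
    also have "\<dots> \<le> norm (T (Q n \<phi>))" unfolding y using sum_ell1_seq_le_norm by simp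
    also have "\<dots> \<le> norm (Q n \<phi>)" by (rule T_upper[OF Q_in])
    also have "\<dots> \<le> norm \<phi>" by (rule norm_Q_le)
    finally show "norm (G0 \<phi>) \<le> 1 * norm \<phi>" by simp
  qed simp
  \<comment> \<open>The \<open>c\<close> side loses one factor each to the \<open>x k\<close>, to
    the cut at \<open>m\<close> and to \<open>T_lower\<close>; the \<open>F\<close> side loses only
    the first.\<close>
  have main: "r * norm (F \<psi>) + r * r * r * \<bar>c\<bar> * norm \<psi> \<le> norm ((F + c *\<^sub>R G0) \<psi>)"
    if F: "F \<in> span S" and \<psi>: "Q n \<psi> = \<psi>" for F \<psi> c
  proof -
    have "F \<psi> = (\<Sum>i<n. \<psi> (e i) *\<^sub>R F (a i))"
      by (subst \<psi>[symmetric]) (simp add: Q_def blinfun.sum_right blinfun.scaleR_right)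
    moreover have "F (a i) \<in> span SX" if "i < n" for i
      using F
    proof (induction rule: span_induct_alt)
      case base
      then show ?case by (simp add: span_zero)
    next
      case (step c F F')
      then show ?case using that
        by (auto simp: SX_def blinfun.add_left blinfun.scaleR_left intro!: span_add span_mul intro: span_base)
    qed
    ultimately have F\<psi>: "F \<psi> \<in> span SX"
      by (auto intro!: span_sum span_mul)
    have "T \<psi> \<in> span (T ` a ` {..<n})"
      using TQ[of \<psi>] \<psi> by (auto intro!: span_sum span_mul intro: span_base)
    then have "r * norm (T \<psi>) \<le> (\<Sum>k<m. \<bar>\<psi> (y k)\<bar>)" unfolding y \<psi> by (rule m)
    moreover have "r * (r * norm \<psi>) \<le> r * norm (T \<psi>)"
      using T_lower[OF Q_in, of \<psi>] r by (intro mult_left_mono) (auto simp: \<psi>)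
    ultimately have low: "r * r * norm \<psi> \<le> (\<Sum>k<m. \<bar>\<psi> (y k)\<bar>)" by simp
    have "r * norm (F \<psi>) + r * r * r * \<bar>c\<bar> * norm \<psi> = r * (norm (F \<psi>) + \<bar>c\<bar> * (r * r * norm \<psi>))"
      by (simp add: algebra_simps)
    also have "\<dots> \<le> r * (norm (F \<psi>) + \<bar>c\<bar> * (\<Sum>k<m. \<bar>\<psi> (y k)\<bar>))"
      using r low by (intro mult_left_mono add_left_mono) auto
    also have "\<dots> = r * (norm (F \<psi>) + (\<Sum>k<m. \<bar>c * \<psi> (y k)\<bar>))"
      by (simp add: abs_mult sum_distrib_left)
    also have "\<dots> \<le> norm (F \<psi> + (\<Sum>k<m. (c * \<psi> (y k)) *\<^sub>R x k))" by (rule x[rule_format, OF F\<psi>])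
    also have "\<dots> = norm ((F + c *\<^sub>R G0) \<psi>)"
      by (simp add: blinfun.add_left blinfun.scaleR_left G0 scaleR_sum_right)
    finally show ?thesis by (simp add: algebra_simps)
  qed
  have a0: "a 0 \<noteq> 0" using biorthogonal[of 0 0] by auto
  have "Q n (a 0) = a 0" using Q_Q[of 1 n "a 0"] biorthogonal[of 0 0] by (simp add: n_def Q_def)
  then have "r * r * r * norm (a 0) \<le> norm (G0 (a 0))"
    using main[of 0 "a 0" 1] span_zero by auto
  then have "G0 \<noteq> 0" using a0 r by (auto simp: mult_le_0_iff)
  define G where "G = inverse (norm G0) *\<^sub>R G0"
  have "G \<in> H" unfolding G_def using H(1) \<open>G0 \<in> H\<close> by (rule subspace_scale)
  moreover have "norm G = 1" using \<open>G0 \<noteq> 0\<close> by (simp add: G_def)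
  moreover have "(1 - \<epsilon>) * (norm F + \<bar>c\<bar>) \<le> norm (F + c *\<^sub>R G)" if F: "F \<in> span S" for F c
  proof (cases "F = 0")
    case True
    have "\<epsilon> * \<bar>c\<bar> \<ge> 0" using \<open>\<epsilon> > 0\<close> by simp
    then show ?thesis using True \<open>norm G = 1\<close> by (simp add: algebra_simps)
  next
    case False
    obtain \<phi> where \<phi>: "norm \<phi> \<le> 1" "r < norm ((inverse (norm F) *\<^sub>R F) (Q n \<phi>))"
      using n[OF scaled_unit_in_span[OF F False]] by (auto simp: U_def)
    define \<psi> where "\<psi> = Q n \<phi>"
    have \<psi>: "Q n \<psi> = \<psi>" "norm \<psi> \<le> 1"
      using Q_Q norm_Q_le[of n \<phi>] \<phi>(1) by (auto simp: \<psi>_def)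
    have F\<psi>: "r * norm F < norm (F \<psi>)"
      using \<phi>(2) False by (simp add: \<psi>_def[symmetric] blinfun.scaleR_left field_simps)
    have "\<psi> \<noteq> 0" using F\<psi> r False by (auto simp: mult_less_0_iff)
    \<comment> \<open>Since \<open>norm G0 \<le> 1\<close>, normalising the direction can only
      enlarge the coefficient of \<open>G0\<close>.\<close>
    define c' where "c' = c / norm G0"
    have c': "\<bar>c\<bar> \<le> \<bar>c'\<bar>"
      using norm_G0 \<open>G0 \<noteq> 0\<close> by (simp add: c'_def field_simps mult_left_le)
    \<comment> \<open>\<open>Q n\<close> may have shrunk \<open>\<psi>\<close> below norm 1, so the
      estimate carries the factor \<open>norm \<psi>\<close>, which cancels against the operator
      norm at the end.\<close>
    have "(1 - \<epsilon>) * (norm F + \<bar>c\<bar>) * norm \<psi> \<le> (r * r * r) * (norm F + \<bar>c\<bar>) * norm \<psi>"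
      using r3 by (intro mult_right_mono) auto
    also have "\<dots> = r * r * (r * norm F * norm \<psi>) + r * r * r * \<bar>c\<bar> * norm \<psi>"
      by (simp add: algebra_simps)
    also have "\<dots> \<le> 1 * r * norm (F \<psi>) + r * r * r * \<bar>c'\<bar> * norm \<psi>"
    proof (intro add_mono mult_right_mono mult_left_mono)
      have "r * norm F * norm \<psi> \<le> r * norm F * 1" using \<psi> r by (intro mult_left_mono) auto
      then have *: "r * norm F * norm \<psi> \<le> norm (F \<psi>)" using F\<psi> by simp
      have "r * r * (r * norm F * norm \<psi>) \<le> r * r * norm (F \<psi>)"
        using * r by (intro mult_left_mono) auto
      also have "\<dots> \<le> 1 * r * norm (F \<psi>)" using r by (intro mult_right_mono) auto
      finally show "r * r * (r * norm F * norm \<psi>) \<le> 1 * r * norm (F \<psi>)" .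
    qed (use r c' in auto)
    also have "\<dots> \<le> norm ((F + c' *\<^sub>R G0) \<psi>)" using main[OF F \<psi>(1), of c'] by simp
    also have "\<dots> \<le> norm (F + c' *\<^sub>R G0) * norm \<psi>" by (rule norm_blinfun)
    also have "c' *\<^sub>R G0 = c *\<^sub>R G" by (simp add: G_def c'_def divide_inverse)
    finally show ?thesis using \<open>\<psi> \<noteq> 0\<close> by simp
  qed
  ultimately show "\<exists>x\<in>H. norm x = 1 \<and>
      (\<forall>f\<in>span S. \<forall>c. (1 - \<epsilon>) * (norm f + \<bar>c\<bar>) \<le> norm (f + c *\<^sub>R x))" by blast
qed

section \<open>From octahedrality to finite representability\<close>

lemma unit_sphere_span_net:
  fixes S :: "'a::real_normed_vector set"
  assumes "finite S" "\<delta> > 0"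
  obtains K where "finite K" "\<forall>g\<in>K. norm g = 1"
    "\<forall>f\<in>span S. norm f = 1 \<longrightarrow> (\<exists>g\<in>K. norm (f - g) < \<delta>)"
proof -
  have "\<exists>K. finite K \<and> K \<subseteq> {f \<in> span S. norm f = 1} \<and> {f \<in> span S. norm f = 1} \<subseteq> (\<Union>g\<in>K. ball g \<delta>)"
    using seq_compact_imp_totally_bounded[OF compact_imp_seq_compact[OF compact_unit_sphere_span[OF assms(1)]]]
      \<open>\<delta> > 0\<close> by simp
  then obtain K where K: "finite K" "K \<subseteq> {f \<in> span S. norm f = 1}"
    "{f \<in> span S. norm f = 1} \<subseteq> (\<Union>g\<in>K. ball g \<delta>)" by blast
  show thesis
  proof (rule that[of K])
    show "\<forall>f\<in>span S. norm f = 1 \<longrightarrow> (\<exists>g\<in>K. norm (f - g) < \<delta>)"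
    proof (intro ballI impI)
      fix f assume "f \<in> span S" "norm f = 1"
      then obtain g where "g \<in> K" "f \<in> ball g \<delta>" using K(3) by blast
      then show "\<exists>g\<in>K. norm (f - g) < \<delta>"
        by (intro bexI[of _ g]) (auto simp: dist_norm norm_minus_commute)
    qed
  qed (use K in auto)
qed

text \<open>A linear contraction is 1-Lipschitz, so a lower bound on a finite net of the unit sphere
  spreads to the whole sphere and, by homogeneity, to the span.\<close>

lemma fin_rep_ell1I:
  assumes ex: "\<And>K \<delta>. finite K \<Longrightarrow> \<forall>f\<in>K. norm f = 1 \<Longrightarrow> 0 < \<delta> \<Longrightarrow>
    \<exists>T::'z::real_normed_vector \<Rightarrow> ell1. linear T \<and> (\<forall>f. norm (T f) \<le> norm f) \<and> (\<forall>f\<in>K. 1 - \<delta> \<le> norm (T f))"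
  shows "fin_rep_ell1 TYPE('z)"
  unfolding fin_rep_ell1_def
proof (intro allI impI, elim conjE)
  fix S :: "'z set" and \<epsilon> :: real
  assume "finite S" "\<epsilon> > 0"
  define m where "m = 1 / (1 + \<epsilon>)"
  \<comment> \<open>One \<open>\<delta>\<close> is lost at the net point and one on the way to it,
    which leaves exactly \<open>m\<close>.\<close>
  define \<delta> where "\<delta> = (1 - m) / 2"
  have m: "0 < m" "m < 1" "1 \<le> (1 + \<epsilon>) * m" using \<open>\<epsilon> > 0\<close> by (auto simp: m_def)
  then have "\<delta> > 0" by (simp add: \<delta>_def)
  obtain K where K: "finite K" "\<forall>g\<in>K. norm g = 1"
    "\<forall>f\<in>span S. norm f = 1 \<longrightarrow> (\<exists>g\<in>K. norm (f - g) < \<delta>)"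
    by (rule unit_sphere_span_net[OF \<open>finite S\<close> \<open>\<delta> > 0\<close>])
  obtain T :: "'z \<Rightarrow> ell1" where T: "linear T" "\<forall>f. norm (T f) \<le> norm f" "\<forall>f\<in>K. 1 - \<delta> \<le> norm (T f)"
    using ex[OF K(1,2) \<open>\<delta> > 0\<close>] by blast
  have unit: "m \<le> norm (T f)" if f: "f \<in> span S" "norm f = 1" for f
  proof -
    obtain g where g: "g \<in> K" "norm (f - g) < \<delta>" using K(3) f by blast
    have "norm (T g) \<le> norm (T f) + norm (T (f - g))"
      using norm_triangle_ineq4[of "T f" "T (f - g)"] by (simp add: linear_diff[OF T(1)])
    moreover have "norm (T (f - g)) \<le> norm (f - g)" "1 - \<delta> \<le> norm (T g)" using T g by auto
    ultimately show ?thesis using g(2) unfolding \<delta>_def by (simp add: field_simps)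
  qed
  have lower: "m * norm f \<le> norm (T f)" if f: "f \<in> span S" for f
  proof (cases "f = 0")
    case False
    then show ?thesis
      using unit[OF scaled_unit_in_span[OF f False]] by (simp add: linear_scale[OF T(1)] field_simps)
  qed simp
  show "\<exists>T::'z \<Rightarrow> ell1.
           (\<forall>f\<in>span S. \<forall>g\<in>span S. T (f + g) = T f + T g) \<and>
           (\<forall>f\<in>span S. \<forall>c. T (c *\<^sub>R f) = c *\<^sub>R T f) \<and>
           (\<exists>m M. 0 < m \<and> M \<le> (1 + \<epsilon>) * m \<and>
              (\<forall>f\<in>span S. m * norm f \<le> norm (T f) \<and> norm (T f) \<le> M * norm f))"
    using T(2) lower m
    by (intro exI[of _ T] conjI exI[of _ m] exI[of _ 1])
       (auto simp: linear_add[OF T(1)] linear_scale[OF T(1)])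
qed

lemma alg_tensor_iff:
  "T \<in> alg_tensor \<longleftrightarrow> (\<exists>(n::nat) y x. \<forall>\<phi>. blinfun_apply T \<phi> = (\<Sum>i<n. blinfun_apply \<phi> (y i) *\<^sub>R x i))"
  by (simp add: alg_tensor_def)

lemma subspace_alg_tensor: "subspace alg_tensor"
proof (rule subspaceI)
  show "0 \<in> alg_tensor" unfolding alg_tensor_iff by (intro exI[of _ "0::nat"]) simp
next
  fix T1 T2 :: "('a \<Rightarrow>\<^sub>L real) \<Rightarrow>\<^sub>L 'b" assume "T1 \<in> alg_tensor" "T2 \<in> alg_tensor"
  then obtain n1 y1 x1 n2 y2 x2 where
    T: "\<forall>\<phi>. blinfun_apply T1 \<phi> = (\<Sum>i<n1::nat. blinfun_apply \<phi> (y1 i) *\<^sub>R x1 i)"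
       "\<forall>\<phi>. blinfun_apply T2 \<phi> = (\<Sum>i<n2::nat. blinfun_apply \<phi> (y2 i) *\<^sub>R x2 i)"
    unfolding alg_tensor_iff by blast
  have split: "(\<Sum>i<n1 + n2. f i) = (\<Sum>i<n1. f i) + (\<Sum>i<n2. f (n1 + i))" for f :: "nat \<Rightarrow> 'b"
    by (induction n2) (auto simp: add.assoc)
  show "T1 + T2 \<in> alg_tensor" unfolding alg_tensor_iff
    by (intro exI[of _ "n1 + n2"] exI[of _ "\<lambda>i. if i < n1 then y1 i else y2 (i - n1)"]
              exI[of _ "\<lambda>i. if i < n1 then x1 i else x2 (i - n1)"] allI)
       (simp only: split, simp add: blinfun.add_left T)
next
  fix c and T :: "('a \<Rightarrow>\<^sub>L real) \<Rightarrow>\<^sub>L 'b" assume "T \<in> alg_tensor"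
  then obtain n y x where T: "\<forall>\<phi>. blinfun_apply T \<phi> = (\<Sum>i<n::nat. blinfun_apply \<phi> (y i) *\<^sub>R x i)"
    unfolding alg_tensor_iff by blast
  show "c *\<^sub>R T \<in> alg_tensor" unfolding alg_tensor_iff
    by (intro exI[of _ n] exI[of _ y] exI[of _ "\<lambda>i. c *\<^sub>R x i"])
       (simp add: blinfun.scaleR_left T scaleR_sum_right mult.commute)
qed

lemma subspace_closure:
  fixes V :: "'a::real_normed_vector set"
  assumes V: "subspace V"
  shows "subspace (closure V)"
proof (rule subspaceI)
  show "0 \<in> closure V" using subspace_0[OF V] closure_subset by blast
next
  fix x y assume "x \<in> closure V" "y \<in> closure V"
  then obtain f g where "\<forall>n. f n \<in> V" "f \<longlonglongrightarrow> x" "\<forall>n. g n \<in> V" "g \<longlonglongrightarrow> y"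
    unfolding closure_sequential by blast
  then show "x + y \<in> closure V" unfolding closure_sequential
    by (intro exI[of _ "\<lambda>n. f n + g n"]) (auto intro: tendsto_add subspace_add[OF V])
next
  fix c x assume "x \<in> closure V"
  then obtain f where "\<forall>n. f n \<in> V" "f \<longlonglongrightarrow> x" unfolding closure_sequential by blast
  then show "c *\<^sub>R x \<in> closure V" unfolding closure_sequential
    by (intro exI[of _ "\<lambda>n. c *\<^sub>R f n"]) (auto intro: tendsto_scaleR subspace_scale[OF V])
qed

lemma subspace_inj_tensor: "subspace inj_tensor"
  unfolding inj_tensor_def by (intro subspace_closure subspace_alg_tensor)

text \<open>One application of octahedrality to all the rank-one operators gives a single
  \<open>G\<close> for the whole net. Being an operator of norm one it is a contraction, so only the
  lower bound on the net needs smoothness.\<close>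

lemma fin_rep_ell1_if_octahedral:
  assumes smooth: "uniformly_smooth TYPE('y::real_normed_vector)"
    and oct: "octahedral_on (inj_tensor :: (('y \<Rightarrow>\<^sub>L real) \<Rightarrow>\<^sub>L ell1) set)"
  shows "fin_rep_ell1 TYPE('y \<Rightarrow>\<^sub>L real)"
proof (rule fin_rep_ell1I)
  fix K :: "('y \<Rightarrow>\<^sub>L real) set" and \<delta> :: real
  assume K: "finite K" "\<forall>\<phi>\<in>K. norm \<phi> = 1" and "\<delta> > 0"
  then have "\<delta> / 2 > 0" by simp
  obtain \<eta>0 where "\<eta>0 > 0" and \<eta>0: "\<And>\<phi> \<psi> x. norm (\<phi> :: 'y \<Rightarrow>\<^sub>L real) \<le> 1 \<Longrightarrow> norm (\<psi> :: 'y \<Rightarrow>\<^sub>L real) \<le> 1 \<Longrightarrow>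
      norm x = 1 \<Longrightarrow> 1 - \<eta>0 < \<phi> x \<Longrightarrow> 1 - \<eta>0 < \<psi> x \<Longrightarrow> norm (\<phi> - \<psi>) \<le> \<delta> / 2"
    by (rule uniformly_smooth_dual_slices[OF smooth \<open>\<delta> / 2 > 0\<close>]) blast
  \<comment> \<open>Half of \<open>\<delta>\<close> pays for \<open>norm (G \<psi>')\<close> falling
    short of 1, the other half for passing from \<open>\<psi>'\<close> to \<open>\<phi>\<close>;
    \<open>\<eta>0\<close> is the slice width.\<close>
  define \<eta> where "\<eta> = min (min \<eta>0 (\<delta> / 2)) 1"
  have \<eta>: "0 < \<eta>" "\<eta> \<le> \<eta>0" "\<eta> \<le> \<delta> / 2" "\<eta> \<le> 1"
    using \<open>\<eta>0 > 0\<close> \<open>\<delta> > 0\<close> by (auto simp: \<eta>_def)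
  \<comment> \<open>Octahedrality gives (1 - t)(2 - t) >= 2 - 3 t, which then exceeds
    \<open>2 - \<eta>\<close>.\<close>
  define t where "t = \<eta> / 4"
  have t: "0 < t" "t < 1" using \<eta> by (auto simp: t_def)
  have "\<forall>\<phi>\<in>K. \<exists>y. norm y = 1 \<and> 1 - t < \<phi> y"
  proof
    fix \<phi> assume "\<phi> \<in> K"
    then have "1 - t < norm \<phi>" "0 \<le> 1 - t" using K(2) t by auto
    from functional_norming[OF this] show "\<exists>y. norm y = 1 \<and> 1 - t < \<phi> y" by blast
  qed
  from bchoice[OF this] obtain y where
    y: "\<And>\<phi>. \<phi> \<in> K \<Longrightarrow> norm (y \<phi>) = 1" "\<And>\<phi>. \<phi> \<in> K \<Longrightarrow> 1 - t < \<phi> (y \<phi>)"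
    by blast
  define R where "R v = Blinfun (\<lambda>\<phi>. blinfun_apply \<phi> v *\<^sub>R ell1_unit 0)" for v :: 'y
  have R: "R v \<phi> = \<phi> v *\<^sub>R ell1_unit 0" for v \<phi>
  proof -
    have "bounded_linear (\<lambda>\<phi>. blinfun_apply \<phi> v *\<^sub>R ell1_unit 0)"
      by (intro bounded_linear_scaleR_const blinfun.bounded_linear_left)
    then show ?thesis by (simp add: R_def bounded_linear_Blinfun_apply)
  qed
  have R_in: "R v \<in> inj_tensor" for v
  proof -
    have "R v \<in> alg_tensor" unfolding alg_tensor_iff
      by (intro exI[of _ "1::nat"] exI[of _ "\<lambda>_. v"] exI[of _ "\<lambda>_. ell1_unit 0"]) (simp add: R)
    then show ?thesis unfolding inj_tensor_def using closure_subset by blast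
  qed
  have "finite ((\<lambda>\<phi>. R (y \<phi>)) ` K)" "(\<lambda>\<phi>. R (y \<phi>)) ` K \<subseteq> inj_tensor" using K R_in by auto
  from octahedral_onD[OF oct this t(1)]
  obtain G where G: "norm G = 1"
    "\<forall>F\<in>span ((\<lambda>\<phi>. R (y \<phi>)) ` K). \<forall>c. (1 - t) * (norm F + \<bar>c\<bar>) \<le> norm (F + c *\<^sub>R G)"
    by blast
  have "1 - \<delta> \<le> norm (G \<phi>)" if \<phi>: "\<phi> \<in> K" for \<phi>
  proof -
    have "1 - t \<le> norm (R (y \<phi>) \<phi>)" using y(2)[OF \<phi>] by (simp add: R norm_ell1_unit)
    also have "\<dots> \<le> norm (R (y \<phi>))" using norm_blinfun[of "R (y \<phi>)" \<phi>] K(2) \<phi> by simp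
    finally have "(1 - t) * ((1 - t) + 1) \<le> (1 - t) * (norm (R (y \<phi>)) + \<bar>1\<bar>)"
      using t by (intro mult_left_mono) auto
    also have "\<dots> \<le> norm (R (y \<phi>) + 1 *\<^sub>R G)"
      using G(2) \<phi> by (intro G(2)[rule_format] span_base) auto
    also have "(1 - t) * ((1 - t) + 1) = 2 - 3 * t + t * t" by (simp add: algebra_simps)
    finally have "2 - 3 * t \<le> norm (R (y \<phi>) + G)"
      using zero_le_square[of t] unfolding scaleR_one by linarith
    then have "2 - \<eta> < norm (R (y \<phi>) + G)" using t unfolding t_def by simp
    \<comment> \<open>The value is a sum of two terms, each at most 1, so each must exceed
      \<open>1 - \<eta>\<close>.\<close>
    then obtain \<psi> where \<psi>: "norm \<psi> = 1" "2 - \<eta> < norm ((R (y \<phi>) + G) \<psi>)"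
      by (rule blinfun_norming) (use \<eta> in auto)
    have "norm ((R (y \<phi>) + G) \<psi>) \<le> \<bar>\<psi> (y \<phi>)\<bar> + norm (G \<psi>)"
      using norm_triangle_ineq[of "R (y \<phi>) \<psi>" "G \<psi>"] by (simp add: blinfun.add_left R norm_ell1_unit)
    moreover have "\<bar>\<psi> (y \<phi>)\<bar> \<le> 1" using norm_blinfun[of \<psi> "y \<phi>"] \<psi>(1) y(1)[OF \<phi>] by simp
    moreover have "norm (G \<psi>) \<le> 1" using norm_blinfun[of G \<psi>] \<psi>(1) G(1) by simp
    ultimately have 1: "1 - \<eta> < \<bar>\<psi> (y \<phi>)\<bar>" "1 - \<eta> < norm (G \<psi>)" using \<psi>(2) by linarith+
    \<comment> \<open>The slice lemma needs a positive value at \<open>y \<phi>\<close>; changing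
      the sign of \<open>\<psi>\<close> does not affect \<open>norm (G \<psi>)\<close>.\<close>
    obtain \<psi>' :: "'y \<Rightarrow>\<^sub>L real" where \<psi>': "norm \<psi>' = 1" "1 - \<eta> < \<psi>' (y \<phi>)" "1 - \<eta> < norm (G \<psi>')"
    proof (cases "\<psi> (y \<phi>) \<ge> 0")
      case True
      then show ?thesis using 1 \<psi>(1) that[of \<psi>] by simp
    next
      case False
      then show ?thesis using 1 \<psi>(1) that[of "- \<psi>"] by (simp add: blinfun.minus_left blinfun.minus_right)
    qed
    have "norm (\<phi> - \<psi>') \<le> \<delta> / 2"
      using \<psi>' y[OF \<phi>] K(2) \<phi> \<eta> t by (intro \<eta>0[of _ _ "y \<phi>"]) (auto simp: t_def)
    then have "norm (G (\<psi>' - \<phi>)) \<le> \<delta> / 2"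
      using norm_blinfun[of G "\<psi>' - \<phi>"] G(1) by (simp add: norm_minus_commute)
    then have "norm (G \<psi>') \<le> norm (G \<phi>) + \<delta> / 2"
      using norm_triangle_ineq[of "G \<phi>" "G (\<psi>' - \<phi>)"] by (simp add: blinfun.diff_right)
    then show ?thesis using \<psi>'(3) \<eta> by linarith
  qed
  moreover have "norm (G \<phi>) \<le> norm \<phi>" for \<phi> using norm_blinfun[of G \<phi>] G(1) by simp
  moreover have "linear (blinfun_apply G)"
    by (rule bounded_linear.linear[OF blinfun.bounded_linear_right])
  ultimately show "\<exists>T::('y \<Rightarrow>\<^sub>L real) \<Rightarrow> ell1. linear T \<and> (\<forall>f. norm (T f) \<le> norm f) \<and> (\<forall>f\<in>K. 1 - \<delta> \<le> norm (T f))"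
    by (intro exI[of _ "blinfun_apply G"] conjI allI ballI)
qed

section \<open>From an embedding into \<open>L\<^sub>1\<close> to finite representability\<close>

lemma (in finite_measure) integrable_simple_function_real:
  fixes s :: "'a \<Rightarrow> real"
  assumes "simple_function M s"
  shows "integrable M s"
proof -
  have "Bochner_Integration.simple_bochner_integrable M s"
    using assms by (intro simple_bochner_integrable.intros) (simp_all add: less_top[symmetric])
  then show ?thesis
    using has_bochner_integral_simple_bochner_integrable integrable.intros by blast
qed

text \<open>Bochner integrability is by definition approximability by simple functions in this
  sense; one late member of the sequence is taken.\<close>

lemma integrable_simple_approx:
  fixes f :: "'a \<Rightarrow> real"
  assumes f: "integrable M f" and "\<delta> > 0"
  obtains s where "simple_function M s" "integrable M s" "(\<integral>x. \<bar>f x - s x\<bar> \<partial>M) < \<delta>"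
proof -
  obtain s where s: "\<And>i. Bochner_Integration.simple_bochner_integrable M (s i)"
    and lim: "(\<lambda>i. \<integral>\<^sup>+x. norm (f x - s i x) \<partial>M) \<longlonglongrightarrow> 0"
    using f unfolding integrable.simps has_bochner_integral.simps by blast
  have "\<forall>\<^sub>F i in sequentially. (\<integral>\<^sup>+x. norm (f x - s i x) \<partial>M) < ennreal \<delta>"
    using \<open>\<delta> > 0\<close> by (intro order_tendstoD(2)[OF lim]) simp
  then obtain i where i: "(\<integral>\<^sup>+x. norm (f x - s i x) \<partial>M) < ennreal \<delta>"
    by (auto simp: eventually_sequentially)
  have int: "integrable M (s i)"
    using has_bochner_integral_simple_bochner_integrable[OF s] integrable.intros by blast
  have "(\<integral>\<^sup>+x. norm (f x - s i x) \<partial>M) = ennreal (\<integral>x. norm (f x - s i x) \<partial>M)"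
    using f int by (intro nn_integral_eq_integral) auto
  with i have "(\<integral>x. \<bar>f x - s i x\<bar> \<partial>M) < \<delta>"
    by (simp add: ennreal_less_iff integral_nonneg_AE)
  then show thesis using that[of "s i"] int s[of i] by (auto elim: simple_bochner_integrable.cases)
qed

text \<open>Common refinement of partitions: the new level function codes the old level together
  with the value of a simple approximant of the new function, and every approximant factors through
  one of the two components.\<close>

lemma (in finite_measure) common_simple_approx:
  fixes F :: "('a \<Rightarrow> real) set"
  assumes "finite F" "\<forall>f\<in>F. integrable M f" "\<delta> > 0"
  shows "\<exists>p::'a \<Rightarrow> nat. simple_function M p \<and> (\<forall>f\<in>F. \<exists>g. (\<integral>x. \<bar>f x - g (p x)\<bar> \<partial>M) < \<delta>)"
  using assms
proof (induction F)
  case empty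
  then show ?case by (auto intro: simple_function_const)
next
  case (insert f F)
  then obtain p :: "'a \<Rightarrow> nat" where p: "simple_function M p"
    and F: "\<forall>f\<in>F. \<exists>g. (\<integral>x. \<bar>f x - g (p x)\<bar> \<partial>M) < \<delta>" by auto
  have "integrable M f" using insert.prems by simp
  then obtain s where s: "simple_function M s" "(\<integral>x. \<bar>f x - s x\<bar> \<partial>M) < \<delta>"
    using integrable_simple_approx[OF _ \<open>\<delta> > 0\<close>] by blast
  have fin: "countable (s ` space M)"
    using simple_functionD(1)[OF s(1)] by (rule countable_finite)
  define q where "q x = prod_encode (p x, to_nat_on (s ` space M) (s x))" for x
  have "simple_function M q"
    unfolding q_def using p s(1)
      simple_function_compose1[where f = "\<lambda>x. (p x, s x)" and g = "\<lambda>(i, v). prod_encode (i, to_nat_on (s ` space M) v)"]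
    by auto
  moreover have "\<exists>g. (\<integral>x. \<bar>h x - g (q x)\<bar> \<partial>M) < \<delta>" if h: "h \<in> insert f F" for h
  proof (cases "h = f")
    case True
    have "(\<integral>x. \<bar>f x - (from_nat_into (s ` space M) \<circ> snd \<circ> prod_decode) (q x)\<bar> \<partial>M) = (\<integral>x. \<bar>f x - s x\<bar> \<partial>M)"
      by (intro Bochner_Integration.integral_cong) (auto simp: q_def from_nat_into_to_nat_on[OF fin])
    with s(2) show ?thesis unfolding True by metis
  next
    case False
    then obtain g where "(\<integral>x. \<bar>h x - g (p x)\<bar> \<partial>M) < \<delta>" using F h by blast
    then have "(\<integral>x. \<bar>h x - (g \<circ> fst \<circ> prod_decode) (q x)\<bar> \<partial>M) < \<delta>" by (simp add: q_def)
    then show ?thesis by blast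
  qed
  ultimately show ?case by blast
qed

text \<open>Averaging over the finite partition into the level sets of \<open>p\<close> is a contraction from
  \<open>L\<^sub>1\<close> into \<open>\<ell>\<^sub>1\<close>, isometric on functions that are constant on the level sets.\<close>

definition level_integral :: "'a measure \<Rightarrow> ('a \<Rightarrow> nat) \<Rightarrow> ('a \<Rightarrow> real) \<Rightarrow> nat \<Rightarrow> real" where
  "level_integral M p f k = (\<integral>x. (if p x = k then f x else 0) \<partial>M)"

lemma (in finite_measure) integrable_level:
  fixes f :: "'a \<Rightarrow> real"
  assumes p: "simple_function M p" and f: "integrable M f"
  shows "integrable M (\<lambda>x. if p x = k then f x else 0)"
proof -
  have "{x \<in> space M. p x = k} \<in> sets M"
    using simple_functionD(2)[OF p, of "{k}"] by (simp add: vimage_def Int_def conj_commute)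
  from integrable_real_mult_indicator[OF this f] show ?thesis
    by (rule Bochner_Integration.integrable_cong[THEN iffD1, rotated -1]) (auto simp: indicator_def)
qed

lemma (in finite_measure) sum_level:
  fixes f :: "'a \<Rightarrow> real"
  assumes p: "simple_function M p" and f: "integrable M f"
  shows "(\<Sum>k\<in>p ` space M. level_integral M p f k) = (\<integral>x. f x \<partial>M)"
proof -
  have fin: "finite (p ` space M)" using p by (rule simple_functionD)
  have "(\<Sum>k\<in>p ` space M. level_integral M p f k) = (\<integral>x. (\<Sum>k\<in>p ` space M. if p x = k then f x else 0) \<partial>M)"
    unfolding level_integral_def by (intro Bochner_Integration.integral_sum[symmetric] integrable_level p f)
  also have "\<dots> = (\<integral>x. f x \<partial>M)"
    by (intro Bochner_Integration.integral_cong) (auto simp: fin)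
  finally show ?thesis .
qed

lemma (in finite_measure) sum_abs_level_le:
  fixes f :: "'a \<Rightarrow> real"
  assumes p: "simple_function M p" and f: "integrable M f"
  shows "(\<Sum>k\<in>p ` space M. \<bar>level_integral M p f k\<bar>) \<le> (\<integral>x. \<bar>f x\<bar> \<partial>M)"
proof -
  have "\<bar>level_integral M p f k\<bar> \<le> level_integral M p (\<lambda>x. \<bar>f x\<bar>) k" for k
  proof -
    have "\<bar>level_integral M p f k\<bar> \<le> (\<integral>x. \<bar>if p x = k then f x else 0\<bar> \<partial>M)"
      unfolding level_integral_def by (rule integral_abs_bound)
    also have "\<dots> = level_integral M p (\<lambda>x. \<bar>f x\<bar>) k"
      unfolding level_integral_def by (intro Bochner_Integration.integral_cong) auto
    finally show ?thesis .
  qed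
  then have "(\<Sum>k\<in>p ` space M. \<bar>level_integral M p f k\<bar>) \<le> (\<Sum>k\<in>p ` space M. level_integral M p (\<lambda>x. \<bar>f x\<bar>) k)"
    by (rule sum_mono)
  also have "\<dots> = (\<integral>x. \<bar>f x\<bar> \<partial>M)" by (intro sum_level p integrable_abs f)
  finally show ?thesis .
qed

text \<open>On a level set the function is constant, so integration over it cancels nothing.\<close>

lemma (in finite_measure) sum_abs_level_compose:
  fixes g :: "nat \<Rightarrow> real"
  assumes p: "simple_function M p"
  shows "(\<Sum>k\<in>p ` space M. \<bar>level_integral M p (\<lambda>x. g (p x)) k\<bar>) = (\<integral>x. \<bar>g (p x)\<bar> \<partial>M)"
proof -
  have const: "level_integral M p (\<lambda>x. h (p x)) k = h k * level_integral M p (\<lambda>x. 1) k" for h k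
  proof -
    have "level_integral M p (\<lambda>x. h (p x)) k = (\<integral>x. h k * (if p x = k then 1 else 0) \<partial>M)"
      unfolding level_integral_def by (intro Bochner_Integration.integral_cong) auto
    then show ?thesis by (simp add: level_integral_def)
  qed
  have "level_integral M p (\<lambda>x. 1) k \<ge> 0" for k
    unfolding level_integral_def by (rule integral_nonneg_AE) auto
  then have "\<bar>level_integral M p (\<lambda>x. g (p x)) k\<bar> = level_integral M p (\<lambda>x. \<bar>g (p x)\<bar>) k" for k
    using const[of g k] const[of "\<lambda>v. \<bar>g v\<bar>" k] by (simp add: abs_mult)
  then show ?thesis
    using p by (simp add: sum_level integrable_simple_function_real simple_function_compose1)
qed

text \<open>The error is counted twice: once in replacing \<open>f\<close> by a function of the
  level, on which averaging is isometric, and once in returning to \<open>f\<close> after averaging,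
  which is a contraction.\<close>

lemma (in finite_measure) sum_abs_level_ge:
  fixes f :: "'a \<Rightarrow> real"
  assumes p: "simple_function M p" and f: "integrable M f"
  shows "(\<integral>x. \<bar>f x\<bar> \<partial>M) \<le> (\<Sum>k\<in>p ` space M. \<bar>level_integral M p f k\<bar>) + 2 * (\<integral>x. \<bar>f x - g (p x)\<bar> \<partial>M)"
proof -
  have g: "integrable M (\<lambda>x. g (p x))"
    by (rule integrable_simple_function_real[OF simple_function_compose1[OF p]])
  have d: "integrable M (\<lambda>x. f x - g (p x))" using f g by simp
  have "(\<integral>x. \<bar>f x\<bar> \<partial>M) \<le> (\<integral>x. \<bar>g (p x)\<bar> + \<bar>f x - g (p x)\<bar> \<partial>M)"
    using f g d by (intro integral_mono) auto
  also have "\<dots> = (\<Sum>k\<in>p ` space M. \<bar>level_integral M p (\<lambda>x. g (p x)) k\<bar>) + (\<integral>x. \<bar>f x - g (p x)\<bar> \<partial>M)"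
    using g d by (simp add: sum_abs_level_compose[OF p])
  also have "(\<Sum>k\<in>p ` space M. \<bar>level_integral M p (\<lambda>x. g (p x)) k\<bar>) \<le>
      (\<Sum>k\<in>p ` space M. \<bar>level_integral M p f k\<bar> + \<bar>level_integral M p (\<lambda>x. f x - g (p x)) k\<bar>)"
  proof (rule sum_mono)
    fix k
    have "level_integral M p (\<lambda>x. f x - g (p x)) k =
        (\<integral>x. (if p x = k then f x else 0) - (if p x = k then g (p x) else 0) \<partial>M)"
      unfolding level_integral_def by (intro Bochner_Integration.integral_cong) auto
    also have "\<dots> = level_integral M p f k - level_integral M p (\<lambda>x. g (p x)) k"
      unfolding level_integral_def
      by (intro Bochner_Integration.integral_diff integrable_level p f g)
    finally show "\<bar>level_integral M p (\<lambda>x. g (p x)) k\<bar> \<le>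
        \<bar>level_integral M p f k\<bar> + \<bar>level_integral M p (\<lambda>x. f x - g (p x)) k\<bar>" by linarith
  qed
  also have "\<dots> \<le> (\<Sum>k\<in>p ` space M. \<bar>level_integral M p f k\<bar>) + (\<integral>x. \<bar>f x - g (p x)\<bar> \<partial>M)"
    using sum_abs_level_le[OF p d] by (simp add: sum.distrib)
  finally show ?thesis by simp
qed

lemma norm_ell1_finite:
  assumes "finite A" "\<And>k. k \<notin> A \<Longrightarrow> f k = 0"
  shows "ell1_seq (Abs_ell1 f) = f" and "norm (Abs_ell1 f) = (\<Sum>k\<in>A. \<bar>f k\<bar>)"
proof -
  have "summable (\<lambda>k. \<bar>f k\<bar>)" using assms by (intro summable_finite[of A]) auto
  then show eq: "ell1_seq (Abs_ell1 f) = f" by (simp add: Abs_ell1_inverse)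
  have "(\<lambda>k. \<bar>f k\<bar>) sums (\<Sum>k\<in>A. \<bar>f k\<bar>)" using assms by (intro sums_finite) auto
  then show "norm (Abs_ell1 f) = (\<Sum>k\<in>A. \<bar>f k\<bar>)"
    using norm_ell1_sums[of "Abs_ell1 f"] sums_unique2 unfolding eq by blast
qed

lemma fin_rep_ell1_if_embeds_L1:
  assumes "embeds_L1 TYPE('z::real_normed_vector)"
  shows "fin_rep_ell1 TYPE('z)"
proof (rule fin_rep_ell1I)
  define M where "M = restrict_space lborel {0..1::real}"
  interpret finite_measure M
    by (intro finite_measureI) (simp add: M_def emeasure_restrict_space space_restrict_space)
  from assms obtain T :: "'z \<Rightarrow> real \<Rightarrow> real" where
    T_add: "\<forall>f g. T (f + g) = (\<lambda>t. T f t + T g t)" and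
    T_scale: "\<forall>c f. T (c *\<^sub>R f) = (\<lambda>t. c * T f t)" and
    T_int: "\<forall>f. set_integrable lborel {0..1} (T f) \<and>
             norm f = set_lebesgue_integral lborel {0..1} (\<lambda>t. \<bar>T f t\<bar>)"
    unfolding embeds_L1_def by blast
  have int: "integrable M (T f)" and norm: "norm f = (\<integral>t. \<bar>T f t\<bar> \<partial>M)" for f
    using T_int unfolding M_def set_integrable_def set_lebesgue_integral_def
    by (auto simp: integrable_restrict_space integral_restrict_space)
  fix K :: "'z set" and \<delta> :: real
  assume K: "finite K" "\<forall>f\<in>K. norm f = 1" and "0 < \<delta>"
  \<comment> \<open>The bound \<open>\<delta> / 2\<close> matches the factor 2 in
    \<open>sum_abs_level_ge\<close>.\<close>
  have "\<exists>p::real \<Rightarrow> nat. simple_function M p \<and> (\<forall>f\<in>T ` K. \<exists>g. (\<integral>x. \<bar>f x - g (p x)\<bar> \<partial>M) < \<delta> / 2)"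
    using K \<open>0 < \<delta>\<close> int by (intro common_simple_approx) auto
  then obtain p :: "real \<Rightarrow> nat" where p: "simple_function M p"
    and approx: "\<forall>f\<in>T ` K. \<exists>g. (\<integral>x. \<bar>f x - g (p x)\<bar> \<partial>M) < \<delta> / 2" by blast
  define J where "J f = Abs_ell1 (level_integral M p (T f))" for f
  have fin: "finite (p ` space M)" using p by (rule simple_functionD)
  \<comment> \<open>The level integrals are supported on the finite range of \<open>p\<close>, which
    makes the use of \<open>Abs_ell1\<close> in \<open>J\<close> legitimate.\<close>
  have zero: "level_integral M p h k = 0" if "k \<notin> p ` space M" for h k
  proof -
    have "level_integral M p h k = (\<integral>x. 0 \<partial>M)"
      unfolding level_integral_def using that by (intro Bochner_Integration.integral_cong) auto
    then show ?thesis by simp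
  qed

  note J_norm = norm_ell1_finite(2)[OF fin zero]
  have "linear J"
  proof (rule linearI)
    fix f g :: 'z and c :: real
    have "level_integral M p (T (f + g)) k = level_integral M p (T f) k + level_integral M p (T g) k" for k
    proof -
      have "level_integral M p (T (f + g)) k =
          (\<integral>x. (if p x = k then T f x else 0) + (if p x = k then T g x else 0) \<partial>M)"
        unfolding level_integral_def T_add[rule_format] by (intro Bochner_Integration.integral_cong) auto
      then show ?thesis
        unfolding level_integral_def using integrable_level[OF p int] by simp
    qed
    then show "J (f + g) = J f + J g"
      by (simp add: ell1_seq_inject[symmetric] plus_ell1.rep_eq fun_eq_iff J_def norm_ell1_finite(1)[OF fin zero])
    have "level_integral M p (T (c *\<^sub>R f)) k = c * level_integral M p (T f) k" for k
    proof -
      have "level_integral M p (T (c *\<^sub>R f)) k = (\<integral>x. c * (if p x = k then T f x else 0) \<partial>M)"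
        unfolding level_integral_def T_scale[rule_format] by (intro Bochner_Integration.integral_cong) auto
      then show ?thesis by (simp add: level_integral_def)
    qed
    then show "J (c *\<^sub>R f) = c *\<^sub>R J f"
      by (simp add: ell1_seq_inject[symmetric] scaleR_ell1.rep_eq fun_eq_iff J_def norm_ell1_finite(1)[OF fin zero])
  qed
  moreover have "norm (J f) \<le> norm f" for f
    using sum_abs_level_le[OF p int, of f] by (simp add: J_def J_norm norm[symmetric])
  moreover have "1 - \<delta> \<le> norm (J f)" if "f \<in> K" for f
  proof -
    obtain g where g: "(\<integral>x. \<bar>T f x - g (p x)\<bar> \<partial>M) < \<delta> / 2" using approx \<open>f \<in> K\<close> by blast
    have "norm f \<le> norm (J f) + 2 * (\<integral>x. \<bar>T f x - g (p x)\<bar> \<partial>M)"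
      using sum_abs_level_ge[OF p int, of f g] by (simp add: J_def J_norm norm[symmetric])
    then show ?thesis using g K(2) \<open>f \<in> K\<close> by auto
  qed
  ultimately show "\<exists>J::'z \<Rightarrow> ell1. linear J \<and> (\<forall>f. norm (J f) \<le> norm f) \<and> (\<forall>f\<in>K. 1 - \<delta> \<le> norm (J f))"
    by (intro exI[of _ J]) blast
qed

section \<open>Curves through the Hilbert cube and completeness of \<open>L\<^sub>1\<close>\<close>

text \<open>With these digits the n-th partial sum is the dyadic floor of \<open>x\<close> at scale
  2^-n; \<open>x < 1\<close> makes the integer part vanish.\<close>

lemma binary_expansion:
  fixes x :: real
  assumes "0 \<le> x" "x < 1"
  obtains b :: "nat \<Rightarrow> nat" where "\<And>i. b i \<le> 1" "(\<lambda>i. real (b i) * (1 / 2) ^ Suc i) sums x"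
proof -
  define b where "b i = nat (\<lfloor>2 ^ Suc i * x\<rfloor> mod 2)" for i
  have b1: "b i \<le> 1" for i unfolding b_def using pos_mod_bound[of 2 "\<lfloor>2 ^ Suc i * x\<rfloor>"] by linarith
  have floor_double: "real_of_int \<lfloor>2 * y\<rfloor> = 2 * real_of_int \<lfloor>y\<rfloor> + real (nat (\<lfloor>2 * y\<rfloor> mod 2))" for y :: real
  proof -
    have "\<lfloor>2 * y\<rfloor> div 2 = \<lfloor>y\<rfloor>" using floor_divide_real_eq_div[of 2 "2 * y"] by simp
    then have "\<lfloor>2 * y\<rfloor> = 2 * \<lfloor>y\<rfloor> + \<lfloor>2 * y\<rfloor> mod 2" using div_mult_mod_eq[of "\<lfloor>2 * y\<rfloor>" 2] by simp
    then have "real_of_int \<lfloor>2 * y\<rfloor> = 2 * real_of_int \<lfloor>y\<rfloor> + real_of_int (\<lfloor>2 * y\<rfloor> mod 2)" by linarith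
    then show ?thesis by simp
  qed
  have partial: "(\<Sum>i<n. real (b i) * (1 / 2) ^ Suc i) = real_of_int \<lfloor>2 ^ n * x\<rfloor> / 2 ^ n" for n
  proof (induction n)
    case 0
    have "\<lfloor>x\<rfloor> = 0" using assms by (simp add: floor_eq_iff)
    then show ?case by simp
  next
    case (Suc n)
    have "real_of_int \<lfloor>2 ^ Suc n * x\<rfloor> = 2 * real_of_int \<lfloor>2 ^ n * x\<rfloor> + real (b n)"
      using floor_double[of "2 ^ n * x"] by (simp add: b_def mult.assoc)
    then show ?case using Suc.IH by (simp add: field_simps)
  qed
  have "(\<lambda>n. real_of_int \<lfloor>2 ^ n * x\<rfloor> / 2 ^ n) \<longlonglongrightarrow> x"
  proof (rule tendsto_sandwich)
    show "\<forall>\<^sub>F n in sequentially. x - (1 / 2) ^ n \<le> real_of_int \<lfloor>2 ^ n * x\<rfloor> / 2 ^ n"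
    proof (rule always_eventually, rule allI)
      fix n
      have "2 ^ n * x - 1 \<le> real_of_int \<lfloor>2 ^ n * x\<rfloor>" by linarith
      then have "(2 ^ n * x - 1) / 2 ^ n \<le> real_of_int \<lfloor>2 ^ n * x\<rfloor> / 2 ^ n" by (intro divide_right_mono) auto
      then show "x - (1 / 2) ^ n \<le> real_of_int \<lfloor>2 ^ n * x\<rfloor> / 2 ^ n"
        by (simp add: diff_divide_distrib power_one_over)
    qed
    show "\<forall>\<^sub>F n in sequentially. real_of_int \<lfloor>2 ^ n * x\<rfloor> / 2 ^ n \<le> x"
    proof (rule always_eventually, rule allI)
      fix n
      have "real_of_int \<lfloor>2 ^ n * x\<rfloor> / 2 ^ n \<le> (2 ^ n * x) / 2 ^ n" by (intro divide_right_mono) auto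
      then show "real_of_int \<lfloor>2 ^ n * x\<rfloor> / 2 ^ n \<le> x" by simp
    qed
    have "(\<lambda>n. x - (1 / 2) ^ n) \<longlonglongrightarrow> x - 0" by (intro tendsto_intros LIMSEQ_power_zero) auto
    then show "(\<lambda>n. x - (1 / 2) ^ n) \<longlonglongrightarrow> x" by simp
  qed simp
  then have "(\<lambda>i. real (b i) * (1 / 2) ^ Suc i) sums x"
    unfolding sums_def partial .
  then show thesis using that b1 by blast
qed

text \<open>Schoenberg's device: \<open>wave (3 ^ m * t)\<close> reads off the \<open>m\<close>-th ternary digit of a point
  \<open>t\<close> of the Cantor set, and it is continuous on the whole line.\<close>

definition wave :: "real \<Rightarrow> real" where
  "wave t = max 0 (min 1 (1 / 2 - cos (pi * t)))"

definition cantor_point :: "(nat \<Rightarrow> nat) \<Rightarrow> real" where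
  "cantor_point b = (\<Sum>i. 2 * real (b i) * (1 / 3) ^ Suc i)"

lemma wave_bounds: "0 \<le> wave t" "wave t \<le> 1"
  by (auto simp: wave_def)

lemma continuous_on_wave [continuous_intros]:
  fixes f :: "real \<Rightarrow> real"
  shows "continuous_on A f \<Longrightarrow> continuous_on A (\<lambda>x. wave (f x))"
  unfolding wave_def by (intro continuous_intros)

lemma cantor_point_summable:
  assumes "\<And>i. b i \<le> 1"
  shows "summable (\<lambda>i. 2 * real (b i) * (1 / 3) ^ Suc i)"
proof (rule summable_comparison_test')
  show "summable (\<lambda>i. 2 / 3 * (1 / 3 :: real) ^ i)"
    by (intro summable_mult summable_geometric) simp
  show "norm (2 * real (b i) * (1 / 3) ^ Suc i) \<le> 2 / 3 * (1 / 3) ^ i" if "i \<ge> 0" for i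
    using assms[of i] by (simp add: mult_left_le_one_le)
qed

lemma cantor_point_bounds:
  assumes "\<And>i. b i \<le> 1"
  shows "0 \<le> cantor_point b" "cantor_point b \<le> 1"
proof -
  show "0 \<le> cantor_point b"
    unfolding cantor_point_def by (intro suminf_nonneg cantor_point_summable assms) auto
  have geo: "(\<lambda>i. 2 / 3 * (1 / 3 :: real) ^ i) sums (2 / 3 * (1 / (1 - 1 / 3)))"
    by (intro sums_mult geometric_sums) simp
  have "cantor_point b \<le> (\<Sum>i. 2 / 3 * (1 / 3) ^ i)"
    unfolding cantor_point_def
  proof (rule suminf_le)
    show "2 * real (b i) * (1 / 3) ^ Suc i \<le> 2 / 3 * (1 / 3) ^ i" for i
      using assms[of i] by (simp add: mult_left_le_one_le)
  qed (use cantor_point_summable assms geo in \<open>auto simp: sums_iff\<close>)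
  then show "cantor_point b \<le> 1" using geo by (simp add: sums_iff)
qed

lemma cantor_point_shift:
  assumes "\<And>i. b i \<le> 1"
  shows "3 * cantor_point b = 2 * real (b 0) + cantor_point (\<lambda>i. b (Suc i))"
proof -
  have "cantor_point b = 2 / 3 * real (b 0) + (\<Sum>i. 2 * real (b (Suc i)) * (1 / 3) ^ Suc (Suc i))"
    unfolding cantor_point_def by (subst suminf_split_head[OF cantor_point_summable[OF assms]]) simp_all
  moreover have "(\<Sum>i. 2 * real (b (Suc i)) * (1 / 3) ^ Suc (Suc i))
      = (\<Sum>i. (1 / 3) * (2 * real (b (Suc i)) * (1 / 3) ^ Suc i))" by (simp add: mult_ac)
  moreover have "\<dots> = (1 / 3) * cantor_point (\<lambda>i. b (Suc i))"
    unfolding cantor_point_def by (intro suminf_mult cantor_point_summable assms)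
  ultimately show ?thesis by simp
qed

text \<open>Tripling shifts the digits and splits off the even integer \<open>2 * b 0\<close>; it
  stays even when multiplied by a power of 3, so the cosine does not see it.\<close>

lemma cos_cantor_point:
  assumes "\<And>i. b i \<le> 1"
  shows "cos (pi * (3 ^ m * cantor_point b)) = cos (pi * cantor_point (\<lambda>i. b (m + i)))"
  using assms
proof (induction m arbitrary: b)
  case (Suc m)
  have "pi * (3 ^ Suc m * cantor_point b) = pi * (3 ^ m * (3 * cantor_point b))" by simp
  also have "\<dots> = pi * (3 ^ m * cantor_point (\<lambda>i. b (Suc i))) + 2 * pi * real (3 ^ m * b 0)"
    by (subst cantor_point_shift[OF Suc.prems]) (simp add: algebra_simps)
  also have "cos \<dots> = cos (pi * (3 ^ m * cantor_point (\<lambda>i. b (Suc i))))"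
    using cos.plus_of_nat[of "pi * (3 ^ m * cantor_point (\<lambda>i. b (Suc i)))" "3 ^ m * b 0"]
    by (simp add: mult_ac)
  also have "\<dots> = cos (pi * cantor_point (\<lambda>i. b (Suc (m + i))))"
    using Suc.IH[of "\<lambda>i. b (Suc i)"] Suc.prems by simp
  finally show ?case by simp
qed simp

text \<open>After the shift, \<open>s\<close> lies in [0, 1/3] or in [2/3, 1] according to the
  digit. There the cosine is at least 1/2 or at most -1/2, so the clipping in \<open>wave\<close>
  returns the digit exactly.\<close>

lemma wave_cantor_point:
  assumes b: "\<And>i. b i \<le> 1"
  shows "wave (3 ^ m * cantor_point b) = real (b m)"
proof -
  define s where "s = cantor_point (\<lambda>i. b (m + i))"
  define s' where "s' = cantor_point (\<lambda>i. b (m + Suc i))"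
  have s: "3 * s = 2 * real (b m) + s'"
    using cantor_point_shift[of "\<lambda>i. b (m + i)"] b by (simp add: s_def s'_def)
  have s': "0 \<le> s'" "s' \<le> 1"
    using cantor_point_bounds[of "\<lambda>i. b (m + Suc i)"] b by (auto simp: s'_def)
  have wave: "wave (3 ^ m * cantor_point b) = max 0 (min 1 (1 / 2 - cos (pi * s)))"
    unfolding wave_def cos_cantor_point[OF b] s_def ..
  consider "b m = 0" | "b m = 1" using b[of m] by linarith
  then show ?thesis
  proof cases
    case 1
    have "cos (pi / 3) \<le> cos (pi * s)"
      using s s' 1 by (intro cos_monotone_0_pi_le) auto
    then show ?thesis unfolding wave using 1 by (simp add: cos_60)
  next
    case 2
    have "cos (pi * s) \<le> cos (2 * pi / 3)"
      using s s' 2 by (intro cos_monotone_0_pi_le) (auto simp: field_simps)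
    then show ?thesis unfolding wave using 2 by (simp add: cos_120)
  qed
qed

text \<open>A single Cantor point stores the binary digits of all coordinates at once, digit
  \<open>i\<close> of coordinate \<open>j\<close> at position \<open>prod_encode (j, i)\<close>.
  Each \<open>g j\<close> reassembles its own digits by a uniformly convergent series of
  waves.\<close>

lemma cube_filling_curve:
  obtains g :: "nat \<Rightarrow> real \<Rightarrow> real"
  where "\<And>j. continuous_on UNIV (g j)" and "\<And>j t. 0 \<le> g j t \<and> g j t \<le> 1"
    and "\<And>v. (\<And>j. 0 \<le> v j \<and> v j < 1) \<Longrightarrow> \<exists>t. 0 \<le> t \<and> t \<le> 1 \<and> (\<forall>j. g j t = v j)"
proof -
  define summand where "summand j i t = wave (3 ^ prod_encode (j, i) * t) * (1 / 2) ^ Suc i" for j i t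
  have half: "(\<lambda>i. (1 / 2 :: real) ^ Suc i) sums 1" by (rule power_half_series)
  have summand: "norm (summand j i t) \<le> (1 / 2) ^ Suc i" "0 \<le> summand j i t" for j i t
    unfolding summand_def using wave_bounds[of "3 ^ prod_encode (j, i) * t"]
    by (auto simp: abs_mult mult_left_le_one_le)
  have summ: "summable (\<lambda>i. summand j i t)" for j t
    by (rule summable_comparison_test'[OF sums_summable[OF half]]) (use summand in auto)
  define g where "g j t = (\<Sum>i. summand j i t)" for j t
  have "continuous_on UNIV (g j)" for j
  proof (rule uniform_limit_theorem)
    show "uniform_limit UNIV (\<lambda>n t. \<Sum>i<n. summand j i t) (g j) sequentially"
      unfolding g_def by (rule Weierstrass_m_test[OF summand(1) sums_summable[OF half]])
    show "\<forall>\<^sub>F n in sequentially. continuous_on UNIV (\<lambda>t. \<Sum>i<n. summand j i t)"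
      unfolding summand_def by (intro always_eventually allI continuous_intros)
  qed simp
  moreover have "0 \<le> g j t \<and> g j t \<le> 1" for j t
  proof
    show "0 \<le> g j t" unfolding g_def by (intro suminf_nonneg summ summand)
    have "g j t \<le> (\<Sum>i. (1 / 2) ^ Suc i)"
      unfolding g_def using summand(1)[of j _ t] summand(2)[of j _ t]
      by (intro suminf_le summ sums_summable[OF half]) auto
    then show "g j t \<le> 1" using half by (simp add: sums_iff)
  qed
  moreover have "\<exists>t. 0 \<le> t \<and> t \<le> 1 \<and> (\<forall>j. g j t = v j)" if v: "\<And>j. 0 \<le> v j \<and> v j < 1" for v
  proof -
    have "\<forall>j. \<exists>b::nat \<Rightarrow> nat. (\<forall>i. b i \<le> 1) \<and> (\<lambda>i. real (b i) * (1 / 2) ^ Suc i) sums v j"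
    proof
      fix j
      show "\<exists>b::nat \<Rightarrow> nat. (\<forall>i. b i \<le> 1) \<and> (\<lambda>i. real (b i) * (1 / 2) ^ Suc i) sums v j"
        using binary_expansion[of "v j"] v by blast
    qed
    from choice[OF this] obtain B :: "nat \<Rightarrow> nat \<Rightarrow> nat" where B: "\<And>j i. B j i \<le> 1"
      "\<And>j. (\<lambda>i. real (B j i) * (1 / 2) ^ Suc i) sums v j"
      by blast
    define b where "b m = (case prod_decode m of (j, i) \<Rightarrow> B j i)" for m
    have b1: "b m \<le> 1" for m using B(1) by (simp add: b_def split: prod.split)
    have "g j (cantor_point b) = v j" for j
    proof -
      have "summand j i (cantor_point b) = real (B j i) * (1 / 2) ^ Suc i" for i
        unfolding summand_def wave_cantor_point[OF b1] by (simp add: b_def)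
      then have "(\<lambda>i. summand j i (cantor_point b)) sums v j" using B(2)[of j] by (simp only:)
      then show ?thesis unfolding g_def by (rule sums_unique[symmetric])
    qed
    then show ?thesis by (intro exI[of _ "cantor_point b"] conjI allI cantor_point_bounds b1)
  qed
  ultimately show thesis by (rule that)
qed

text \<open>Riesz-Fischer: along a fast subsequence the absolute increments have a finite integral
  of their sum, so they are summable almost everywhere and the subsequence converges there.\<close>

lemma L1_complete_real:
  fixes u :: "nat \<Rightarrow> 'a \<Rightarrow> real"
  assumes u: "\<And>n. integrable M (u n)"
    and cauchy: "\<And>\<epsilon>. \<epsilon> > 0 \<Longrightarrow> \<exists>N. \<forall>m\<ge>N. \<forall>n\<ge>N. (\<integral>x. \<bar>u m x - u n x\<bar> \<partial>M) < \<epsilon>"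
  obtains h where "integrable M h" "(\<lambda>n. \<integral>x. \<bar>h x - u n x\<bar> \<partial>M) \<longlonglongrightarrow> 0"
proof -
  have [measurable]: "u n \<in> borel_measurable M" for n using u by auto
  have "\<forall>k. \<exists>N. \<forall>m\<ge>N. \<forall>n\<ge>N. (\<integral>x. \<bar>u m x - u n x\<bar> \<partial>M) < (1 / 2) ^ k"
    by (intro allI cauchy) simp
  from choice[OF this] obtain N where
    N: "\<And>k m n. m \<ge> N k \<Longrightarrow> n \<ge> N k \<Longrightarrow> (\<integral>x. \<bar>u m x - u n x\<bar> \<partial>M) < (1 / 2) ^ k" by blast
  \<comment> \<open>Summing makes the indices increase and stay above every earlier
    \<open>N i\<close>.\<close>
  define r where "r k = (\<Sum>i\<le>k. N i)" for k
  have r_ge: "N k \<le> r l" if "k \<le> l" for k l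
    unfolding r_def using that by (intro member_le_sum) auto
  have nn: "(\<integral>\<^sup>+x. ennreal \<bar>u m x - u n x\<bar> \<partial>M) = ennreal (\<integral>x. \<bar>u m x - u n x\<bar> \<partial>M)" for m n
    using u by (intro nn_integral_eq_integral) auto
  define d where "d k x = u (r (Suc k)) x - u (r k) x" for k x
  have d_meas [measurable]: "d k \<in> borel_measurable M" for k unfolding d_def by measurable
  have "(\<integral>\<^sup>+x. (\<Sum>k. ennreal \<bar>d k x\<bar>) \<partial>M) = (\<Sum>k. \<integral>\<^sup>+x. ennreal \<bar>d k x\<bar> \<partial>M)"
    by (rule nn_integral_suminf) measurable
  also have "\<dots> \<le> (\<Sum>k. ennreal ((1 / 2) ^ k))"
  proof (rule suminf_le)
    fix k
    have "(\<integral>x. \<bar>d k x\<bar> \<partial>M) \<le> (1 / 2) ^ k"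
      unfolding d_def using N[OF r_ge r_ge, of k "Suc k" k] by simp
    then show "(\<integral>\<^sup>+x. ennreal \<bar>d k x\<bar> \<partial>M) \<le> ennreal ((1 / 2) ^ k)"
      unfolding d_def nn by (rule ennreal_leI)
  qed auto
  also have "\<dots> = ennreal (\<Sum>k. (1 / 2) ^ k)"
    by (intro suminf_ennreal_eq sums_summable summable_sums summable_geometric) auto
  also have "\<dots> < \<infinity>" by simp
  finally have "(\<integral>\<^sup>+x. (\<Sum>k. ennreal \<bar>d k x\<bar>) \<partial>M) \<noteq> \<infinity>" by simp
  then have "AE x in M. (\<Sum>k. ennreal \<bar>d k x\<bar>) \<noteq> \<infinity>"
    by (intro nn_integral_PInf_AE) measurable
  define h where "h x = lim (\<lambda>k. u (r k) x)" for x
  have [measurable]: "h \<in> borel_measurable M" unfolding h_def by measurable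
  have lim: "AE x in M. (\<lambda>k. u (r k) x) \<longlonglongrightarrow> h x"
    using \<open>AE x in M. (\<Sum>k. ennreal \<bar>d k x\<bar>) \<noteq> \<infinity>\<close>
  proof (eventually_elim)
    case (elim x)
    have "summable (\<lambda>k. \<bar>d k x\<bar>)" using elim by (intro summable_suminf_not_top) auto
    then have "summable (\<lambda>k. d k x)" by (rule summable_rabs_cancel)
    then have "convergent (\<lambda>n. \<Sum>k<n. d k x)" by (simp add: summable_iff_convergent)
    then have "convergent (\<lambda>n. (\<Sum>k<n. d k x) + u (r 0) x)"
      by (intro convergent_add convergent_const)
    moreover have "(\<Sum>k<n. d k x) + u (r 0) x = u (r n) x" for n
      unfolding d_def using sum_lessThan_telescope[of "\<lambda>k. u (r k) x" n] by simp
    ultimately show ?case unfolding h_def by (simp add: convergent_LIMSEQ_iff)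
  qed
  \<comment> \<open>Fatou along the subsequence estimates the distance of the limit from every late
    \<open>u m\<close>, so the full sequence converges.\<close>
  have bound: "(\<integral>\<^sup>+x. ennreal \<bar>h x - u m x\<bar> \<partial>M) \<le> ennreal ((1 / 2) ^ K)" if "m \<ge> N K" for m K
  proof -
    have "(\<integral>\<^sup>+x. ennreal \<bar>h x - u m x\<bar> \<partial>M) = (\<integral>\<^sup>+x. liminf (\<lambda>k. ennreal \<bar>u (r k) x - u m x\<bar>) \<partial>M)"
    proof (rule nn_integral_cong_AE, use lim in eventually_elim)
      case (elim x)
      then have "(\<lambda>k. ennreal \<bar>u (r k) x - u m x\<bar>) \<longlonglongrightarrow> ennreal \<bar>h x - u m x\<bar>"
        by (intro tendsto_ennrealI tendsto_intros)
      then show ?case by (intro lim_imp_Liminf[symmetric]) auto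
    qed
    also have "\<dots> \<le> liminf (\<lambda>k. \<integral>\<^sup>+x. ennreal \<bar>u (r k) x - u m x\<bar> \<partial>M)"
      by (rule nn_integral_liminf) measurable
    also have "\<dots> \<le> ennreal ((1 / 2) ^ K)"
    proof (rule Liminf_le)
      show "\<forall>\<^sub>F k in sequentially. (\<integral>\<^sup>+x. ennreal \<bar>u (r k) x - u m x\<bar> \<partial>M) \<le> ennreal ((1 / 2) ^ K)"
        using eventually_ge_at_top[of K]
      proof eventually_elim
        case (elim k)
        then show ?case unfolding nn using N[OF r_ge[OF elim] that] by (intro ennreal_leI) simp
      qed
    qed simp
    finally show ?thesis .
  qed
  have int_diff: "integrable M (\<lambda>x. h x - u (N 0) x)"
  proof (rule integrableI_bounded)
    show "(\<integral>\<^sup>+x. ennreal (norm (h x - u (N 0) x)) \<partial>M) < \<infinity>"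
      using bound[of 0 "N 0"] by (auto intro: le_less_trans)
  qed measurable
  have h: "integrable M h" using Bochner_Integration.integrable_add[OF int_diff u[of "N 0"]] by simp
  have "(\<lambda>n. \<integral>x. \<bar>h x - u n x\<bar> \<partial>M) \<longlonglongrightarrow> 0"
  proof (rule LIMSEQ_I)
    fix \<epsilon> :: real assume "\<epsilon> > 0"
    then obtain K where K: "(1 / 2) ^ K < \<epsilon>" using real_arch_pow_inv[of \<epsilon> "1 / 2"] by auto
    have "norm ((\<integral>x. \<bar>h x - u n x\<bar> \<partial>M) - 0) < \<epsilon>" if "n \<ge> N K" for n
    proof -
      have "(\<integral>\<^sup>+x. ennreal \<bar>h x - u n x\<bar> \<partial>M) = ennreal (\<integral>x. \<bar>h x - u n x\<bar> \<partial>M)"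
        using h u by (intro nn_integral_eq_integral) auto
      then have "(\<integral>x. \<bar>h x - u n x\<bar> \<partial>M) \<le> (1 / 2) ^ K" using bound[OF that] by simp
      then show ?thesis using K by (simp add: integral_nonneg_AE)
    qed
    then show "\<exists>N. \<forall>n\<ge>N. norm ((\<integral>x. \<bar>h x - u n x\<bar> \<partial>M) - 0) < \<epsilon>" by blast
  qed
  with h show thesis by (rule that)
qed

section \<open>From finite representability to an embedding into \<open>L\<^sub>1\<close>\<close>

text \<open>The range is made twice as wide as the targets: they then correspond to cube coordinates
  in [1/4, 3/4], away from the value 1 that the cube curve is not guaranteed to attain.\<close>

lemma scaled_cube_filling_curve:
  fixes B :: "nat \<Rightarrow> real"
  assumes B: "\<And>j. B j > 0"
  shows "\<exists>G :: nat \<Rightarrow> real \<Rightarrow> real. (\<forall>j. continuous_on UNIV (G j)) \<and> (\<forall>j t. \<bar>G j t\<bar> \<le> 2 * B j) \<and>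
    (\<forall>v. (\<forall>j. \<bar>v j\<bar> \<le> B j) \<longrightarrow> (\<exists>t. 0 \<le> t \<and> t \<le> 1 \<and> (\<forall>j. G j t = v j)))"
proof -
  obtain g :: "nat \<Rightarrow> real \<Rightarrow> real" where g: "\<And>j. continuous_on UNIV (g j)" "\<And>j t. 0 \<le> g j t \<and> g j t \<le> 1"
    and onto: "\<And>v. (\<And>j. 0 \<le> v j \<and> v j < 1) \<Longrightarrow> \<exists>t. 0 \<le> t \<and> t \<le> 1 \<and> (\<forall>j. g j t = v j)"
    using cube_filling_curve by blast
  show ?thesis
  proof (intro exI[of _ "\<lambda>j t. B j * (4 * g j t - 2)"] conjI allI impI)
    show "continuous_on UNIV (\<lambda>t. B j * (4 * g j t - 2))" for j
      by (intro continuous_intros g)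
    show "\<bar>B j * (4 * g j t - 2)\<bar> \<le> 2 * B j" for j t
    proof -
      have "\<bar>4 * g j t - 2\<bar> \<le> 2" using g(2)[of j t] by (simp add: abs_le_iff)
      then have "B j * \<bar>4 * g j t - 2\<bar> \<le> B j * 2" using B[of j] by (intro mult_left_mono) auto
      then show ?thesis using B[of j] by (simp add: abs_mult)
    qed
    show "\<exists>t. 0 \<le> t \<and> t \<le> 1 \<and> (\<forall>j. B j * (4 * g j t - 2) = v j)" if v: "\<forall>j. \<bar>v j\<bar> \<le> B j" for v
    proof -
      have "\<exists>t. 0 \<le> t \<and> t \<le> 1 \<and> (\<forall>j. g j t = 1 / 2 + v j / (4 * B j))"
      proof (rule onto)
        fix j
        have "\<bar>v j / (4 * B j)\<bar> \<le> 1 / 4" using v[rule_format, of j] B[of j] by (simp add: abs_mult field_simps)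
        then show "0 \<le> 1 / 2 + v j / (4 * B j) \<and> 1 / 2 + v j / (4 * B j) < 1" by linarith
      qed
      then obtain t where t: "0 \<le> t" "t \<le> 1" "\<And>j. g j t = 1 / 2 + v j / (4 * B j)" by blast
      have "B j * (4 * g j t - 2) = v j" for j using B[of j] by (simp add: t(3) field_simps)
      then show ?thesis using t by blast
    qed
  qed
qed

definition atomic_measure :: "(nat \<Rightarrow> real) \<Rightarrow> (nat \<Rightarrow> real) \<Rightarrow> real measure" where
  "atomic_measure p t = distr (density (count_space UNIV) (\<lambda>k. ennreal (p k))) borel t"

lemma
  assumes p: "\<And>k. p k \<ge> 0" "p sums 1"
  shows real_distribution_atomic: "real_distribution (atomic_measure p t)"
    and measure_atomic: "range t \<subseteq> A \<Longrightarrow> A \<in> sets borel \<Longrightarrow> measure (atomic_measure p t) A = 1"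
proof -
  interpret D: prob_space "density (count_space UNIV) (\<lambda>k. ennreal (p k))"
  proof (rule prob_spaceI)
    have "emeasure (density (count_space UNIV) (\<lambda>k. ennreal (p k))) UNIV = (\<Sum>k. ennreal (p k))"
      by (simp add: emeasure_density nn_integral_count_space_nat)
    also have "\<dots> = ennreal 1" using suminf_ennreal_eq[OF p] .
    finally show "emeasure (density (count_space UNIV) (\<lambda>k. ennreal (p k)))
        (space (density (count_space UNIV) (\<lambda>k. ennreal (p k)))) = 1" by simp
  qed
  have [measurable]: "t \<in> borel_measurable (density (count_space UNIV) (\<lambda>k. ennreal (p k)))"
    by simp
  show "real_distribution (atomic_measure p t)"
    unfolding atomic_measure_def by (rule D.real_distribution_distr) measurable
  assume "range t \<subseteq> A" "A \<in> sets borel"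
  then have "measure (atomic_measure p t) A = measure (density (count_space UNIV) (\<lambda>k. ennreal (p k))) (t -` A)"
    unfolding atomic_measure_def by (subst measure_distr) auto
  also have "t -` A = space (density (count_space UNIV) (\<lambda>k. ennreal (p k)))"
    using \<open>range t \<subseteq> A\<close> by auto
  finally show "measure (atomic_measure p t) A = 1" using D.prob_space by simp
qed

lemma integral_atomic:
  fixes H :: "real \<Rightarrow> real"
  assumes p: "\<And>k. p k \<ge> 0" and H: "H \<in> borel_measurable borel" "\<And>x. H x \<ge> 0"
    and sums: "(\<lambda>k. p k * H (t k)) sums s"
  shows "(\<integral>x. H x \<partial>atomic_measure p t) = s"
proof -
  have "(\<integral>x. H x \<partial>atomic_measure p t) = (\<integral>k. H (t k) \<partial>density (count_space UNIV) (\<lambda>k. ennreal (p k)))"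
    unfolding atomic_measure_def by (rule integral_distr) (use H in auto)
  also have "\<dots> = (\<integral>k. p k *\<^sub>R H (t k) \<partial>count_space UNIV)"
    by (rule integral_density) (use p in auto)
  also have "\<dots> = (\<Sum>k. p k *\<^sub>R H (t k))"
    using sums p H(2) by (intro integral_count_space_nat)
      (auto simp: integrable_count_space_nat_iff abs_mult sums_iff)
  finally show ?thesis using sums by (simp add: sums_iff)
qed

text \<open>Almost isometries \<open>T n\<close> of the spans into \<open>\<ell>\<^sub>1\<close> are turned, by a change of density, into random
  variables that are bounded independently of \<open>n\<close>; so their joint laws live on a fixed cube, and a
  weak limit of the laws represents the norm exactly.\<close>

lemma L1_representation:
  fixes f :: "nat \<Rightarrow> 'z::real_normed_vector"
  assumes rep: "fin_rep_ell1 TYPE('z)" and nz: "\<And>j. f j \<noteq> 0"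
  shows "\<exists>(M :: real measure) (G :: nat \<Rightarrow> real \<Rightarrow> real) (C :: nat \<Rightarrow> real). real_distribution M \<and>
    (\<forall>j. continuous_on UNIV (G j)) \<and> (\<forall>j t. \<bar>G j t\<bar> \<le> C j) \<and>
    (\<forall>m c. (\<integral>x. \<bar>\<Sum>j<m. c j * G j x\<bar> \<partial>M) = norm (\<Sum>j<m. c j *\<^sub>R f j))"
proof -
  define r :: "nat \<Rightarrow> real" where "r n = 1 - (1 / 2) ^ Suc n" for n
  have r: "0 < r n" "r n < 1" for n
    using power_Suc_less_one[of "1 / 2 :: real" n] by (auto simp: r_def)
  have half_lim: "(\<lambda>n. (1 / 2 :: real) ^ Suc n) \<longlonglongrightarrow> 0"
    by (rule LIMSEQ_Suc[OF LIMSEQ_power_zero]) simp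
  have r_lim: "r \<longlonglongrightarrow> 1"
    unfolding r_def[abs_def] using tendsto_diff[OF tendsto_const half_lim, of 1] by simp
  have "\<forall>n. \<exists>T::'z \<Rightarrow> ell1. linear T \<and>
      (\<forall>x\<in>span (f ` {..<n}). r n * norm x \<le> norm (T x) \<and> norm (T x) \<le> norm x)"
  proof
    fix n
    show "\<exists>T::'z \<Rightarrow> ell1. linear T \<and>
      (\<forall>x\<in>span (f ` {..<n}). r n * norm x \<le> norm (T x) \<and> norm (T x) \<le> norm x)"
      by (rule fin_rep_ell1_linear[OF rep _ r, of "f ` {..<n}" n]) auto
  qed
  from choice[OF this] obtain T :: "nat \<Rightarrow> 'z \<Rightarrow> ell1" where T: "\<And>n. linear (T n)"
    and T_lower: "\<And>n x. x \<in> span (f ` {..<n}) \<Longrightarrow> r n * norm x \<le> norm (T n x)"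
    and T_upper: "\<And>n x. x \<in> span (f ` {..<n}) \<Longrightarrow> norm (T n x) \<le> norm x" by blast
  \<comment> \<open>The numbers \<open>\<beta> j * norm (f j)\<close> sum to 1 over all
    \<open>j\<close>, so the total mass \<open>W n\<close> tends to 1.\<close>
  define \<beta> where "\<beta> j = (1 / 2) ^ Suc j / norm (f j)" for j
  have \<beta>: "\<beta> j > 0" for j using nz[of j] by (simp add: \<beta>_def)
  define F where "F n j k = ell1_seq (T n (f j)) k" for n j k
  \<comment> \<open>The new density. It dominates \<open>\<beta> j * \<bar>F n j k\<bar>\<close> for
    each \<open>j < n\<close>, hence the quotients by it are bounded by \<open>1 / \<beta> j\<close>
    whatever \<open>n\<close> is.\<close>
  define w where "w n k = (\<Sum>j<n. \<beta> j * \<bar>F n j k\<bar>)" for n k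
  define W where "W n = (\<Sum>j<n. \<beta> j * norm (T n (f j)))" for n
  have w_nonneg: "w n k \<ge> 0" for n k
    unfolding w_def by (intro sum_nonneg mult_nonneg_nonneg less_imp_le[OF \<beta>]) auto
  have w_sums: "w n sums W n" for n
    unfolding w_def[abs_def] W_def F_def by (intro sums_sum sums_mult norm_ell1_sums)
  have half: "(\<Sum>j<n. (1 / 2 :: real) ^ Suc j) = 1 - (1 / 2) ^ n" for n
    by (induction n) auto
  have f_span: "f j \<in> span (f ` {..<n})" if "j < n" for j n using that by (intro span_base) auto
  have W_upper: "W n \<le> 1" for n
  proof -
    have "W n \<le> (\<Sum>j<n. \<beta> j * norm (f j))"
      unfolding W_def using \<beta> by (intro sum_mono mult_left_mono T_upper f_span less_imp_le) auto
    also have "\<dots> = (\<Sum>j<n. (1 / 2) ^ Suc j)" using nz by (simp add: \<beta>_def)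
    also have "\<dots> \<le> 1" unfolding half by simp
    finally show ?thesis .
  qed
  have W_lower: "r n * (1 - (1 / 2) ^ n) \<le> W n" for n
  proof -
    have "r n * (1 - (1 / 2) ^ n) = (\<Sum>j<n. \<beta> j * (r n * norm (f j)))"
      unfolding half[symmetric] sum_distrib_left using nz by (intro sum.cong) (auto simp: \<beta>_def)
    also have "\<dots> \<le> W n"
      unfolding W_def using \<beta> by (intro sum_mono mult_left_mono T_lower f_span less_imp_le) auto
    finally show ?thesis .
  qed
  have W_pos: "W (Suc n) > 0" for n
  proof -
    have "(1 / 2 :: real) ^ Suc n < 1" by (rule power_Suc_less_one) auto
    then have "0 < r (Suc n) * (1 - (1 / 2) ^ Suc n)" using r by (intro mult_pos_pos) auto
    then show ?thesis using W_lower[of "Suc n"] by linarith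
  qed
  \<comment> \<open>The value 0 where \<open>w\<close> vanishes is harmless, because there all
    \<open>F n j k\<close> with \<open>j < n\<close> vanish too; for \<open>j \<ge> n\<close> it
    only completes the point of the cube.\<close>
  define u where "u n k j = (if j < n \<and> w n k \<noteq> 0 then F n j k / w n k else 0)" for n k j
  have F_le_w: "\<beta> j * \<bar>F n j k\<bar> \<le> w n k" if "j < n" for n j k
    unfolding w_def using that
    by (intro member_le_sum mult_nonneg_nonneg less_imp_le[OF \<beta>]) auto
  have u_bound: "\<bar>u n k j\<bar> \<le> 1 / \<beta> j" for n k j
  proof (cases "j < n \<and> w n k \<noteq> 0")
    case True
    then have "w n k > 0" using w_nonneg[of n k] by simp
    then show ?thesis using True F_le_w[of j n k] \<beta>[of j] by (simp add: u_def field_simps)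
  next
    case False
    then show ?thesis using \<beta>[of j] by (auto simp: u_def)
  qed
  have wu: "w n k * u n k j = F n j k" if "j < n" for n k j
  proof (cases "w n k = 0")
    case True
    then have "\<beta> j * \<bar>F n j k\<bar> \<le> 0" using F_le_w[OF that, of k] by simp
    then have "F n j k = 0" using \<beta>[of j] by (simp add: mult_le_0_iff)
    then show ?thesis using True by simp
  qed (simp add: u_def that)
  have \<beta>': "1 / \<beta> j > 0" for j using \<beta> by simp
  from scaled_cube_filling_curve[of "\<lambda>j. 1 / \<beta> j", OF \<beta>'] obtain G :: "nat \<Rightarrow> real \<Rightarrow> real" where
    G': "\<forall>j. continuous_on UNIV (G j)" "\<forall>j t. \<bar>G j t\<bar> \<le> 2 * (1 / \<beta> j)"
    and onto: "\<forall>v. (\<forall>j. \<bar>v j\<bar> \<le> 1 / \<beta> j) \<longrightarrow> (\<exists>t. 0 \<le> t \<and> t \<le> 1 \<and> (\<forall>j. G j t = v j))"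
    by (elim exE conjE)
  note G = G'[rule_format]
  define \<tau> where "\<tau> n k = (SOME t. 0 \<le> t \<and> t \<le> 1 \<and> (\<forall>j. G j t = u n k j))" for n k
  have \<tau>: "0 \<le> \<tau> n k \<and> \<tau> n k \<le> 1 \<and> (\<forall>j. G j (\<tau> n k) = u n k j)" for n k
    unfolding \<tau>_def by (rule someI_ex[OF onto[rule_format, of "u n k", OF u_bound]])
  \<comment> \<open>The index is shifted because \<open>W 0\<close> is an empty sum and cannot be
    normalised to 1.\<close>
  define \<mu> where "\<mu> n = atomic_measure (\<lambda>k. w (Suc n) k / W (Suc n)) (\<tau> (Suc n))" for n
  have p: "w (Suc n) k / W (Suc n) \<ge> 0" "(\<lambda>k. w (Suc n) k / W (Suc n)) sums 1" for n k
  proof -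
    show "w (Suc n) k / W (Suc n) \<ge> 0" using w_nonneg W_pos[of n] by simp
    show "(\<lambda>k. w (Suc n) k / W (Suc n)) sums 1"
      using sums_divide[OF w_sums, of "Suc n" "W (Suc n)"] W_pos[of n] by simp
  qed
  have \<mu>: "real_distribution (\<mu> n)" for n
    unfolding \<mu>_def by (rule real_distribution_atomic[OF p])
  have "tight \<mu>"
    unfolding tight_def
  proof (intro conjI allI impI)
    fix \<epsilon> :: real assume "\<epsilon> > 0"
    \<comment> \<open>\<open>tight\<close> uses half-open intervals; the left end lies below 0 so
      that the code 0 is included.\<close>
    have "measure (\<mu> n) {-1<..1} = 1" for n
      unfolding \<mu>_def
    proof (rule measure_atomic[OF p])
      show "range (\<tau> (Suc n)) \<subseteq> {-1<..1}"
      proof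
        fix x assume "x \<in> range (\<tau> (Suc n))"
        then obtain k where "x = \<tau> (Suc n) k" by blast
        then show "x \<in> {-1<..1}" using \<tau>[of "Suc n" k] by simp
      qed
    qed simp
    then show "\<exists>a b. a < b \<and> (\<forall>n. 1 - \<epsilon> < measure (\<mu> n) {a<..b})"
      using \<open>\<epsilon> > 0\<close> by (intro exI[of _ "-1"] exI[of _ 1]) auto
  qed (rule \<mu>)
  from tight_imp_convergent_subsubsequence[OF this strict_mono_id]
  obtain s M where s: "strict_mono s" and M: "real_distribution M" and "weak_conv_m (\<mu> \<circ> id \<circ> s) M"
    by blast
  then have conv: "weak_conv_m (\<lambda>n. \<mu> (s n)) M" by (simp add: comp_def)
  have "(\<integral>x. \<bar>\<Sum>j<m. c j * G j x\<bar> \<partial>M) = norm (\<Sum>j<m. c j *\<^sub>R f j)" for m c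
  proof -
    define H where "H x = \<bar>\<Sum>j<m. c j * G j x\<bar>" for x
    define z where "z = (\<Sum>j<m. c j *\<^sub>R f j)"
    have H_cont: "continuous_on UNIV H" unfolding H_def by (intro continuous_intros G)
    \<comment> \<open>The weights cancel the division by the density atom by atom, so up to
      normalisation the integral is the ell_1 norm of the image of \<open>z\<close>.\<close>
    have int: "(\<integral>x. H x \<partial>\<mu> n) = norm (T (Suc n) z) / W (Suc n)" if "n \<ge> m" for n
      unfolding \<mu>_def
    proof (rule integral_atomic[OF p(1)])
      have "w (Suc n) k * H (\<tau> (Suc n) k) = \<bar>ell1_seq (T (Suc n) z) k\<bar>" for k
      proof -
        have "w (Suc n) k * H (\<tau> (Suc n) k) = \<bar>w (Suc n) k * (\<Sum>j<m. c j * u (Suc n) k j)\<bar>"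
          using \<tau> w_nonneg by (simp add: H_def abs_mult)
        also have "w (Suc n) k * (\<Sum>j<m. c j * u (Suc n) k j) = (\<Sum>j<m. c j * (w (Suc n) k * u (Suc n) k j))"
          by (simp add: sum_distrib_left mult_ac)
        also have "\<dots> = (\<Sum>j<m. c j * F (Suc n) j k)"
          using that by (intro sum.cong) (auto simp: wu)
        also have "\<dots> = ell1_seq (T (Suc n) z) k"
          by (simp add: z_def F_def linear_sum[OF T] linear_scale[OF T] ell1_seq_sum scaleR_ell1.rep_eq)
        finally show ?thesis .
      qed
      then have "(\<lambda>k. w (Suc n) k * H (\<tau> (Suc n) k)) sums norm (T (Suc n) z)"
        using norm_ell1_sums by simp
      from sums_divide[OF this, of "W (Suc n)"]
      show "(\<lambda>k. w (Suc n) k / W (Suc n) * H (\<tau> (Suc n) k)) sums (norm (T (Suc n) z) / W (Suc n))"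
        by simp
      show "H \<in> borel_measurable borel" using H_cont by (rule borel_measurable_continuous_onI)
    qed (simp add: H_def)
    \<comment> \<open>From below \<open>W \<le> 1\<close> and \<open>T_lower\<close> are used, from
      above \<open>T_upper\<close> and \<open>W_lower\<close>; all constants tend to 1.\<close>
    have lim1: "(\<lambda>n. \<integral>x. H x \<partial>\<mu> n) \<longlonglongrightarrow> norm z"
    proof (rule tendsto_sandwich)
      have z: "z \<in> span (f ` {..<Suc n})" if "n \<ge> m" for n
        unfolding z_def using that by (intro span_sum span_mul f_span) auto
      show "\<forall>\<^sub>F n in sequentially. r (Suc n) * norm z \<le> (\<integral>x. H x \<partial>\<mu> n)"
        using eventually_ge_at_top[of m]
      proof eventually_elim
        case (elim n)
        have "r (Suc n) * norm z \<le> norm (T (Suc n) z)" by (rule T_lower[OF z[OF elim]])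
        also have "\<dots> \<le> norm (T (Suc n) z) / W (Suc n)"
          using W_pos[of n] W_upper[of "Suc n"] by (simp add: field_simps mult_left_le_one_le)
        finally show ?case unfolding int[OF elim] .
      qed
      show "\<forall>\<^sub>F n in sequentially. (\<integral>x. H x \<partial>\<mu> n) \<le> norm z / (r (Suc n) * (1 - (1 / 2) ^ Suc n))"
        using eventually_ge_at_top[of m]
      proof eventually_elim
        case (elim n)
        have "(1 / 2 :: real) ^ Suc n < 1" by (rule power_Suc_less_one) auto
        then have "0 < r (Suc n) * (1 - (1 / 2) ^ Suc n)" using r by (intro mult_pos_pos) auto
        then show ?case unfolding int[OF elim]
          by (intro frac_le T_upper z elim W_lower) auto
      qed
      have r_lim': "(\<lambda>n. r (Suc n)) \<longlonglongrightarrow> 1" using r_lim by (rule LIMSEQ_Suc)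
      then have "(\<lambda>n. r (Suc n) * norm z) \<longlonglongrightarrow> 1 * norm z" by (intro tendsto_intros)
      then show "(\<lambda>n. r (Suc n) * norm z) \<longlonglongrightarrow> norm z" by simp
      from r_lim' half_lim
      have "(\<lambda>n. norm z / (r (Suc n) * (1 - (1 / 2) ^ Suc n))) \<longlonglongrightarrow> norm z / (1 * (1 - 0))"
        by (intro tendsto_intros) auto
      then show "(\<lambda>n. norm z / (r (Suc n) * (1 - (1 / 2) ^ Suc n))) \<longlonglongrightarrow> norm z" by simp
    qed
    \<comment> \<open>The bound on \<open>G\<close> holds on the whole line, so \<open>H\<close> is
      an admissible test function for weak convergence.\<close>
    have lim2: "(\<lambda>n. \<integral>x. H x \<partial>\<mu> (s n)) \<longlonglongrightarrow> (\<integral>x. H x \<partial>M)"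
    proof (rule weak_conv_imp_integral_bdd_continuous_conv[OF \<mu> M conv])
      show "isCont H x" for x using H_cont by (simp add: continuous_on_eq_continuous_at)
      show "norm (H x) \<le> (\<Sum>j<m. \<bar>c j\<bar> * (2 * (1 / \<beta> j)))" for x
      proof -
        have "norm (H x) \<le> (\<Sum>j<m. \<bar>c j * G j x\<bar>)" unfolding H_def using sum_abs by simp
        also have "\<dots> \<le> (\<Sum>j<m. \<bar>c j\<bar> * (2 * (1 / \<beta> j)))"
          unfolding abs_mult by (intro sum_mono mult_left_mono G) auto
        finally show ?thesis .
      qed
    qed
    have "(\<lambda>n. \<integral>x. H x \<partial>\<mu> (s n)) \<longlonglongrightarrow> norm z"
      using LIMSEQ_subseq_LIMSEQ[OF lim1 s] by (simp add: comp_def)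
    from LIMSEQ_unique[OF lim2 this] show ?thesis by (simp add: H_def z_def)
  qed
  with M G show ?thesis
    by (intro exI[of _ M] exI[of _ G] exI[of _ "\<lambda>j. 2 * (1 / \<beta> j)"] conjI allI)
qed

section \<open>From the span of the basis functionals to the whole dual\<close>

lemma sum_pad:
  fixes c x :: "nat \<Rightarrow> 'a::semiring_1"
  assumes "m \<le> N"
  shows "(\<Sum>j<N. (if j < m then c j else 0) * x j) = (\<Sum>j<m. c j * x j)"
  using assms by (intro sum.mono_neutral_cong_right) auto

text \<open>The representation is isometric on combinations of the \<open>a j\<close>, so it carries
  the norm-convergent sequence \<open>Q n \<phi>\<close> to a Cauchy sequence in L_1, whose limit
  represents \<open>\<phi>\<close>.\<close>

lemma (in shrinking_monotone_basis) embeds_L1_if_fin_rep: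
  assumes rep: "fin_rep_ell1 TYPE('y \<Rightarrow>\<^sub>L real)"
  shows "embeds_L1 TYPE('y \<Rightarrow>\<^sub>L real)"
proof -
  have "a j \<noteq> 0" for j using biorthogonal[of j j] by auto
  from L1_representation[of a, OF rep this]
  obtain M :: "real measure" and G :: "nat \<Rightarrow> real \<Rightarrow> real" and C :: "nat \<Rightarrow> real" where
    M: "real_distribution M" and G_cont: "\<forall>j. continuous_on UNIV (G j)" and G_bound: "\<forall>j t. \<bar>G j t\<bar> \<le> C j"
    and G_norm: "\<forall>m c. (\<integral>x. \<bar>\<Sum>j<m. c j * G j x\<bar> \<partial>M) = norm (\<Sum>j<m. c j *\<^sub>R a j)"
    by (elim exE conjE)
  interpret M: cdf_distribution M unfolding cdf_distribution_def by (rule M)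
  \<comment> \<open>The quantile function \<open>M.I\<close> is used on the open unit interval,
    where its law under Lebesgue measure is \<open>M\<close>.\<close>
  define \<Omega> where "\<Omega> = restrict_space lborel {0<..<1::real}"
  interpret \<Omega>: prob_space \<Omega>
    by (auto simp: \<Omega>_def emeasure_restrict_space space_restrict_space intro!: prob_spaceI)
  define X where "X = M.I"
  have X: "X \<in> borel_measurable \<Omega>"
  proof -
    have "sets \<Omega> = sets (restrict_space borel {0<..<1::real})"
      unfolding \<Omega>_def by (rule sets_restrict_space_cong) simp
    then show ?thesis using M.measurable_CI unfolding X_def by (simp cong: measurable_cong_sets)
  qed
  have distr_X: "distr \<Omega> borel X = M" unfolding \<Omega>_def X_def by (rule M.distr_I_eq_M)
  have [measurable]: "G j \<in> borel_measurable borel" for j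
    using G_cont by (intro borel_measurable_continuous_onI) blast
  define h where "h j \<omega> = G j (X \<omega>)" for j \<omega>
  have h_meas: "h j \<in> borel_measurable \<Omega>" for j
    unfolding h_def using X by measurable
  have h_int: "integrable \<Omega> (h j)" for j
    using G_bound by (intro \<Omega>.integrable_const_bound[of _ "C j"] h_meas) (auto simp: h_def)
  have h_norm: "(\<integral>\<omega>. \<bar>\<Sum>j<m. c j * h j \<omega>\<bar> \<partial>\<Omega>) = norm (\<Sum>j<m. c j *\<^sub>R a j)" for m c
  proof -
    have "(\<integral>\<omega>. \<bar>\<Sum>j<m. c j * h j \<omega>\<bar> \<partial>\<Omega>) = (\<integral>x. \<bar>\<Sum>j<m. c j * G j x\<bar> \<partial>distr \<Omega> borel X)"
      unfolding h_def by (rule integral_distr[symmetric, OF X]) measurable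
    then show ?thesis unfolding distr_X using G_norm by simp
  qed
  define u where "u \<phi> n \<omega> = (\<Sum>j<n. \<phi> (e j) * h j \<omega>)" for \<phi> :: "'y \<Rightarrow>\<^sub>L real" and n \<omega>
  have u_int: "integrable \<Omega> (u \<phi> n)" for \<phi> n
    unfolding u_def using h_int by simp
  have u_norm: "(\<integral>\<omega>. \<bar>u \<phi> n \<omega>\<bar> \<partial>\<Omega>) = norm (Q n \<phi>)" for \<phi> n
    unfolding u_def h_norm Q_def ..
  have u_diff: "(\<integral>\<omega>. \<bar>u \<phi> m \<omega> - u \<phi> n \<omega>\<bar> \<partial>\<Omega>) = norm (Q m \<phi> - Q n \<phi>)" for \<phi> m n
  proof -
    \<comment> \<open>Both partial sums are padded with zeros to a common length, so that their
      difference is one combination to which \<open>h_norm\<close> applies.\<close>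
    define N where "N = max m n"
    define c where "c j = (if j < m then \<phi> (e j) else 0) - (if j < n then \<phi> (e j) else 0)" for j
    have mn: "m \<le> N" "n \<le> N" by (auto simp: N_def)
    have "u \<phi> m \<omega> - u \<phi> n \<omega> = (\<Sum>j<N. c j * h j \<omega>)" for \<omega>
      unfolding u_def c_def left_diff_distrib sum_subtractf sum_pad[OF mn(1)] sum_pad[OF mn(2)] ..
    moreover have "Q m \<phi> - Q n \<phi> = (\<Sum>j<N. c j *\<^sub>R a j)"
    proof -
      have pad: "(\<Sum>j<N. (if j < k then \<phi> (e j) else 0) *\<^sub>R a j) = Q k \<phi>" if "k \<le> N" for k
        unfolding Q_def using that by (intro sum.mono_neutral_cong_right) auto
      show ?thesis unfolding c_def scaleR_diff_left sum_subtractf pad[OF mn(1)] pad[OF mn(2)] ..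
    qed
    ultimately show ?thesis by (simp only: h_norm)
  qed
  \<comment> \<open>A relation, since an L_1 limit is determined only almost everywhere.\<close>
  define R where "R \<phi> g \<longleftrightarrow> integrable \<Omega> g \<and> (\<lambda>n. \<integral>\<omega>. \<bar>g \<omega> - u \<phi> n \<omega>\<bar> \<partial>\<Omega>) \<longlonglongrightarrow> 0"
    for \<phi> :: "'y \<Rightarrow>\<^sub>L real" and g
  have "\<forall>\<phi>. \<exists>g. R \<phi> g"
  proof
    fix \<phi>
    have cauchy: "\<exists>N. \<forall>m\<ge>N. \<forall>n\<ge>N. (\<integral>\<omega>. \<bar>u \<phi> m \<omega> - u \<phi> n \<omega>\<bar> \<partial>\<Omega>) < \<epsilon>" if "\<epsilon> > 0" for \<epsilon>
      unfolding u_diff using CauchyD[OF LIMSEQ_imp_Cauchy[OF Q_tendsto] that] .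
    obtain g where "integrable \<Omega> g" "(\<lambda>n. \<integral>\<omega>. \<bar>g \<omega> - u \<phi> n \<omega>\<bar> \<partial>\<Omega>) \<longlonglongrightarrow> 0"
      by (rule L1_complete_real[OF u_int cauchy])
    then show "\<exists>g. R \<phi> g" unfolding R_def by blast
  qed
  from choice[OF this] obtain g where g: "\<forall>\<phi>. R \<phi> (g \<phi>)" by blast
  \<comment> \<open>\<open>embeds_L1\<close> demands representatives that are linear pointwise, not just almost everywhere:
    \<open>L\<^sub>1\<close>-limits are therefore chosen on a Hamel basis only.\<close>
  obtain B :: "('y \<Rightarrow>\<^sub>L real) set" where B: "independent B" "UNIV \<subseteq> span B"
    by (rule maximal_independent_subset[of UNIV])
  have "\<forall>t. \<exists>L :: ('y \<Rightarrow>\<^sub>L real) \<Rightarrow> real. linear L \<and> (\<forall>b\<in>B. L b = g b t)"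
    by (intro allI linear_independent_extend[OF B(1)])
  from choice[OF this] obtain L :: "real \<Rightarrow> ('y \<Rightarrow>\<^sub>L real) \<Rightarrow> real" where
    L: "\<forall>t. linear (L t) \<and> (\<forall>b\<in>B. L t b = g b t)" by blast
  have L_add: "L t (\<phi> + \<psi>) = L t \<phi> + L t \<psi>" and L_scale: "L t (c *\<^sub>R \<phi>) = c * L t \<phi>" for t \<phi> \<psi> c
    using L linear_add[of "L t"] linear_scale[of "L t"] by auto
  \<comment> \<open>\<open>R\<close> is compatible with linear combinations, and each
    \<open>\<phi>\<close> is a finite combination of elements of \<open>B\<close>. So the pointwise
    linear extension is still an L_1 limit of \<open>u \<phi> n\<close> for every
    \<open>\<phi>\<close>.\<close>
  have R_L: "R \<phi> (\<lambda>t. L t \<phi>)" for \<phi>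
  proof -
    have "\<phi> \<in> span B" using B by blast
    then show ?thesis
    proof (induction rule: span_induct_alt)
      case base
      have "L t 0 = 0" for t using L_scale[of t 0 0] by simp
      then show ?case by (simp add: R_def u_def)
    next
      case (step c b \<psi>)
      have Lb: "(\<lambda>t. L t b) = g b" using L step by auto
      have b: "integrable \<Omega> (\<lambda>t. L t b)" "(\<lambda>n. \<integral>t. \<bar>L t b - u b n t\<bar> \<partial>\<Omega>) \<longlonglongrightarrow> 0"
        using g Lb unfolding R_def by (metis, metis)
      have \<psi>: "integrable \<Omega> (\<lambda>t. L t \<psi>)" "(\<lambda>n. \<integral>t. \<bar>L t \<psi> - u \<psi> n t\<bar> \<partial>\<Omega>) \<longlonglongrightarrow> 0"
        using step unfolding R_def by auto
      have int: "integrable \<Omega> (\<lambda>t. L t (c *\<^sub>R b + \<psi>))" using b(1) \<psi>(1) by (simp add: L_add L_scale)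
      have u_lin: "u (c *\<^sub>R b + \<psi>) n t = c * u b n t + u \<psi> n t" for n t
        by (simp add: u_def blinfun.add_left blinfun.scaleR_left distrib_right sum.distrib sum_distrib_left mult.assoc)
      have le: "(\<integral>t. \<bar>L t (c *\<^sub>R b + \<psi>) - u (c *\<^sub>R b + \<psi>) n t\<bar> \<partial>\<Omega>)
          \<le> \<bar>c\<bar> * (\<integral>t. \<bar>L t b - u b n t\<bar> \<partial>\<Omega>) + (\<integral>t. \<bar>L t \<psi> - u \<psi> n t\<bar> \<partial>\<Omega>)" for n
      proof -
        have "(\<integral>t. \<bar>L t (c *\<^sub>R b + \<psi>) - u (c *\<^sub>R b + \<psi>) n t\<bar> \<partial>\<Omega>)
            \<le> (\<integral>t. \<bar>c\<bar> * \<bar>L t b - u b n t\<bar> + \<bar>L t \<psi> - u \<psi> n t\<bar> \<partial>\<Omega>)"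
        proof (rule integral_mono)
          fix t
          have "L t (c *\<^sub>R b + \<psi>) - u (c *\<^sub>R b + \<psi>) n t = c * (L t b - u b n t) + (L t \<psi> - u \<psi> n t)"
            unfolding L_add L_scale u_lin by (simp add: algebra_simps)
          then show "\<bar>L t (c *\<^sub>R b + \<psi>) - u (c *\<^sub>R b + \<psi>) n t\<bar> \<le> \<bar>c\<bar> * \<bar>L t b - u b n t\<bar> + \<bar>L t \<psi> - u \<psi> n t\<bar>"
            using abs_triangle_ineq[of "c * (L t b - u b n t)" "L t \<psi> - u \<psi> n t"] by (simp add: abs_mult)
        qed (use int b(1) \<psi>(1) u_int in auto)
        also have "\<dots> = \<bar>c\<bar> * (\<integral>t. \<bar>L t b - u b n t\<bar> \<partial>\<Omega>) + (\<integral>t. \<bar>L t \<psi> - u \<psi> n t\<bar> \<partial>\<Omega>)"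
          using b(1) \<psi>(1) u_int by simp
        finally show ?thesis .
      qed
      have lim0: "(\<lambda>n. \<bar>c\<bar> * (\<integral>t. \<bar>L t b - u b n t\<bar> \<partial>\<Omega>) + (\<integral>t. \<bar>L t \<psi> - u \<psi> n t\<bar> \<partial>\<Omega>)) \<longlonglongrightarrow> 0"
        using tendsto_add[OF tendsto_mult_left[OF b(2), of "\<bar>c\<bar>"] \<psi>(2)] by (simp only: mult_zero_right add_0)
      have "(\<lambda>n. \<integral>t. \<bar>L t (c *\<^sub>R b + \<psi>) - u (c *\<^sub>R b + \<psi>) n t\<bar> \<partial>\<Omega>) \<longlonglongrightarrow> 0"
      proof (rule tendsto_sandwich[OF _ _ tendsto_const lim0])
        show "\<forall>\<^sub>F n in sequentially. 0 \<le> (\<integral>t. \<bar>L t (c *\<^sub>R b + \<psi>) - u (c *\<^sub>R b + \<psi>) n t\<bar> \<partial>\<Omega>)"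
          by (intro always_eventually allI integral_nonneg_AE) auto
        show "\<forall>\<^sub>F n in sequentially. (\<integral>t. \<bar>L t (c *\<^sub>R b + \<psi>) - u (c *\<^sub>R b + \<psi>) n t\<bar> \<partial>\<Omega>)
            \<le> \<bar>c\<bar> * (\<integral>t. \<bar>L t b - u b n t\<bar> \<partial>\<Omega>) + (\<integral>t. \<bar>L t \<psi> - u \<psi> n t\<bar> \<partial>\<Omega>)"
          by (intro always_eventually allI le)
      qed
      then show ?case unfolding R_def using int by blast
    qed
  qed
  have L_norm: "norm \<phi> = (\<integral>t. \<bar>L t \<phi>\<bar> \<partial>\<Omega>)" for \<phi>
  proof -
    have int: "integrable \<Omega> (\<lambda>t. L t \<phi>)" and lim: "(\<lambda>n. \<integral>t. \<bar>L t \<phi> - u \<phi> n t\<bar> \<partial>\<Omega>) \<longlonglongrightarrow> 0"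
      using R_L unfolding R_def by auto
    have bound: "\<bar>(\<integral>t. \<bar>u \<phi> n t\<bar> \<partial>\<Omega>) - (\<integral>t. \<bar>L t \<phi>\<bar> \<partial>\<Omega>)\<bar> \<le> (\<integral>t. \<bar>L t \<phi> - u \<phi> n t\<bar> \<partial>\<Omega>)" for n
    proof -
      have "(\<integral>t. \<bar>u \<phi> n t\<bar> \<partial>\<Omega>) - (\<integral>t. \<bar>L t \<phi>\<bar> \<partial>\<Omega>) = (\<integral>t. \<bar>u \<phi> n t\<bar> - \<bar>L t \<phi>\<bar> \<partial>\<Omega>)"
        using int u_int by (intro Bochner_Integration.integral_diff[symmetric]) auto
      also have "\<bar>\<dots>\<bar> \<le> (\<integral>t. \<bar>\<bar>u \<phi> n t\<bar> - \<bar>L t \<phi>\<bar>\<bar> \<partial>\<Omega>)" by (rule integral_abs_bound)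
      also have "\<dots> \<le> (\<integral>t. \<bar>L t \<phi> - u \<phi> n t\<bar> \<partial>\<Omega>)"
        using int u_int by (intro integral_mono) auto
      finally show ?thesis .
    qed
    have "(\<lambda>n. (\<integral>t. \<bar>u \<phi> n t\<bar> \<partial>\<Omega>) - (\<integral>t. \<bar>L t \<phi>\<bar> \<partial>\<Omega>)) \<longlonglongrightarrow> 0"
      by (rule Lim_null_comparison[OF always_eventually lim]) (use bound in auto)
    then have "(\<lambda>n. norm (Q n \<phi>)) \<longlonglongrightarrow> (\<integral>t. \<bar>L t \<phi>\<bar> \<partial>\<Omega>)"
      unfolding u_norm by (rule LIM_zero_cancel)
    moreover have "(\<lambda>n. norm (Q n \<phi>)) \<longlonglongrightarrow> norm \<phi>" by (intro tendsto_norm Q_tendsto)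
    ultimately show ?thesis using LIMSEQ_unique by blast
  qed
  \<comment> \<open>Vanishing off the open interval makes integration over \<open>{0..1}\<close>
    agree with integration over \<open>\<Omega>\<close> and preserves pointwise linearity.\<close>
  define T where "T \<phi> t = indicator {0<..<1} t * L t \<phi>" for \<phi> t
  have ind: "indicator {0..1} t *\<^sub>R T \<phi> t = indicator {0<..<1} t *\<^sub>R L t \<phi>"
    "indicator {0..1} t *\<^sub>R \<bar>T \<phi> t\<bar> = indicator {0<..<1} t *\<^sub>R \<bar>L t \<phi>\<bar>" for \<phi> t
    by (auto simp: T_def indicator_def)
  show ?thesis
    unfolding embeds_L1_def
  proof (intro exI[of _ T] conjI allI)
    show "T (\<phi> + \<psi>) = (\<lambda>t. T \<phi> t + T \<psi> t)" for \<phi> \<psi>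
      by (simp add: T_def L_add distrib_left fun_eq_iff)
    show "T (c *\<^sub>R \<phi>) = (\<lambda>t. c * T \<phi> t)" for c \<phi>
      by (simp add: T_def L_scale fun_eq_iff)
    show "set_integrable lborel {0..1} (T \<phi>)" for \<phi>
      using R_L[of \<phi>] unfolding R_def set_integrable_def ind \<Omega>_def
      by (simp add: integrable_restrict_space)
    show "norm \<phi> = set_lebesgue_integral lborel {0..1} (\<lambda>t. \<bar>T \<phi> t\<bar>)" for \<phi>
      unfolding set_lebesgue_integral_def ind L_norm \<Omega>_def
      by (simp add: integral_restrict_space)
  qed
qed

section \<open>Assembling the equivalences\<close>

lemma prop1_imp_prop2:
  assumes "prop1 TYPE('a::real_normed_vector) TYPE('b::real_normed_vector)"
  shows "prop2 TYPE('a) TYPE('b)"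
proof -
  have "closed (inj_tensor :: (('a \<Rightarrow>\<^sub>L real) \<Rightarrow>\<^sub>L 'b) set)"
    and "(alg_tensor :: (('a \<Rightarrow>\<^sub>L real) \<Rightarrow>\<^sub>L 'b) set) \<subseteq> inj_tensor"
    by (simp_all add: inj_tensor_def closure_subset)
  then show ?thesis
    using assms subspace_inj_tensor[where 'a = 'a and 'b = 'b] unfolding prop1_def prop2_def by blast
qed

lemma prop2_ell1D:
  assumes "prop2 TYPE('a::real_normed_vector) TYPE(ell1)"
  shows "octahedral_on (inj_tensor :: (('a \<Rightarrow>\<^sub>L real) \<Rightarrow>\<^sub>L ell1) set)"
  using assms complete_ell1 octahedral_ell1 unfolding prop2_def by simp

lemma (in shrinking_monotone_basis) prop1_if_fin_rep:
  "fin_rep_ell1 TYPE('y \<Rightarrow>\<^sub>L real) \<Longrightarrow> prop1 TYPE('y) TYPE('x::real_normed_vector)"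
  unfolding prop1_def by (intro impI allI octahedral_operators) auto

text \<open>A formula cannot quantify over types, so "for every Banach space X" is split: the
  implications out of (1) and (2) use the instance \<open>ell1\<close>, those into them hold for an
  arbitrary type \<open>'x\<close>, and completeness of the space is a premise inside
  \<open>prop1\<close> and \<open>prop2\<close>.\<close>

theorem mainTheorem8:
  fixes e :: "nat \<Rightarrow> 'y::banach"
  assumes "uniformly_smooth TYPE('y)"
    and "monotone_schauder_basis e"
  shows "(prop1 TYPE('y) TYPE(ell1) \<longrightarrow> octahedral_on (inj_tensor :: (('y \<Rightarrow>\<^sub>L real) \<Rightarrow>\<^sub>L ell1) set))
     \<and> (prop2 TYPE('y) TYPE(ell1) \<longrightarrow> octahedral_on (inj_tensor :: (('y \<Rightarrow>\<^sub>L real) \<Rightarrow>\<^sub>L ell1) set))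
     \<and> (octahedral_on (inj_tensor :: (('y \<Rightarrow>\<^sub>L real) \<Rightarrow>\<^sub>L ell1) set) \<longrightarrow> prop1 TYPE('y) TYPE('x::real_normed_vector))
     \<and> (octahedral_on (inj_tensor :: (('y \<Rightarrow>\<^sub>L real) \<Rightarrow>\<^sub>L ell1) set) \<longrightarrow> prop2 TYPE('y) TYPE('x))
     \<and> (octahedral_on (inj_tensor :: (('y \<Rightarrow>\<^sub>L real) \<Rightarrow>\<^sub>L ell1) set) \<longleftrightarrow> fin_rep_ell1 TYPE('y \<Rightarrow>\<^sub>L real))
     \<and> (fin_rep_ell1 TYPE('y \<Rightarrow>\<^sub>L real) \<longleftrightarrow> embeds_L1 TYPE('y \<Rightarrow>\<^sub>L real))"
proof -
  obtain a where "shrinking_monotone_basis e a"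
    using shrinking_monotone_basisI[OF assms] .
  then interpret shrinking_monotone_basis e a .
  let ?oct = "octahedral_on (inj_tensor :: (('y \<Rightarrow>\<^sub>L real) \<Rightarrow>\<^sub>L ell1) set)"
  let ?rep = "fin_rep_ell1 TYPE('y \<Rightarrow>\<^sub>L real)"
  have 34: "?oct \<Longrightarrow> ?rep" by (rule fin_rep_ell1_if_octahedral[OF assms(1)])
  \<comment> \<open>The detour through (1) and (2) at \<open>ell1\<close> is possible because
    \<open>ell1\<close> is itself complete and octahedral.\<close>
  have 43: "?rep \<Longrightarrow> ?oct" using prop1_if_fin_rep prop1_imp_prop2 prop2_ell1D by blast
  have 45: "?rep \<longleftrightarrow> embeds_L1 TYPE('y \<Rightarrow>\<^sub>L real)"
    using embeds_L1_if_fin_rep fin_rep_ell1_if_embeds_L1 by blast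
  show ?thesis
    using prop1_imp_prop2[where 'a = 'y and 'b = ell1] prop1_imp_prop2[where 'a = 'y and 'b = 'x]
      prop2_ell1D[where 'a = 'y] prop1_if_fin_rep[where 'x = 'x] 34 43 45 by blast
qed

end
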